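(* Let $X_{\omega+1}=(\bigsqcup_{n\ge 1}X_n,d)$ be the metric space defined in the context. Then its transfinite asymptotic dimension and its complementary-finite asymptotic dimension are both equal to $\omega+1$, where $\omega$ is the smallest infinite ordinal; that is, $\operatorname{trasdim}(X_{\omega+1})=\omega+1$ and $\operatorname{coasdim}(X_{\omega+1})=\omega+1$.
   Context: Here $\mathbb{N}=\{1,2,3,\dots\}$. **Families of subsets.** Let $(X,d)$ be a metric space. For $U,V\subseteq X$ put $\operatorname{diam}U=\sup\{d(x,y): x,y\in U\}$ and $d(U,V)=\inf\{d(x,y): x\in U, y\in V\}$. A family $\mathcal U$ of subsets of $X$ is *$R$-bounded* ($R>0$) if $\sup\{\operatorname{diam}U: U\in\mathcal U\}\le R$, and *uniformly bounded* if it is $R$-bounded for some $R>0$. It is *$r$-disjoint* ($r>0$) if $d(U,V)\ge r$ for all $U,V\in\mathcal U$ with $U\ne V$. Write $\bigcup\mathcal U=\bigcup\{U:U\in\mathcal U\}$. **Transfinite asymptotic dimension.** Let $Fin\,\mathbb N$ be the collection of all finite nonempty subsets of $\mathbb N$. For $M\subseteq Fin\,\mathbb N$ and $a\in\mathbb N$ let $M^{a}=\{\tau\in Fin\,\mathbb N : \tau\cup\{a\}\in M,\ a\notin\tau\}$. Define $\operatorname{Ord}M$ inductively: $\operatorname{Ord}M=0$ iff $M=\varnothing$; for an ordinal $\alpha>0$, $\operatorname{Ord}M\le\alpha$ iff $\operatorname{Ord}M^{a}<\alpha$ for every $a\in\mathbb N$; $\operatorname{Ord}M=\alpha$ iff $\operatorname{Ord}M\le\alpha$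 and $\operatorname{Ord}M<\alpha$ is not true; $\operatorname{Ord}M=\infty$ iff $\operatorname{Ord}M\le\alpha$ is not true for every ordinal $\alpha$. For a metric space $(X,d)$ let $A(X,d)$ be the set of all $\sigma\in Fin\,\mathbb N$ for which there are no uniformly bounded families $\mathcal U_i$ ($i\in\sigma$) of subsets of $X$ such that each $\mathcal U_i$ is $i$-disjoint and $\bigcup_{i\in\sigma}\mathcal U_i$ covers $X$. Then $\operatorname{trasdim}(X)=\operatorname{Ord}A(X,d)$. **Complementary-finite asymptotic dimension.** Every ordinal $\gamma$ is written uniquely as $\gamma=\lambda(\gamma)+n(\gamma)$ with $\lambda(\gamma)$ a limit ordinal or $0$ and $n(\gamma)\in\mathbb N\cup\{0\}$. Define inductively: $\operatorname{coasdim}(X)=-1$ iff $X=\varnothing$ (with $-1$ regarded as smaller than every ordinal); $\operatorname{coasdim}(X)\le\gamma$ iff for every $r>0$ there are $r$-disjoint uniformly bounded families $\mathcal U_0,\dots,\mathcal U_{n(\gamma)}$ of subsets of $X$ such that $\operatorname{coasdim}\bigl(X\setminus\bigcup(\bigcup_{i=0}^{n(\gamma)}\mathcal U_i)\bigr)<\lambda(\gamma)$ (subsets carry the restricted metric); $\operatorname{coasdim}(X)=\gamma$ iff $\operatorname{coasdim}(X)\le\gamma$ and $\operatorname{coasdim}(X)\le\beta$ is not true for every $\beta<\gamma$; $\operatorname{coasdim}(X)=\infty$ iff $\operatorname{coasdim}(X)\le\gamma$ is not true for every ordinal $\gamma$. **The space $X_{\omega+1}$.** For $n\in\mathbb N$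 let $X_n\subseteq\mathbb R^n$ be the set of points $(x_1,\dots,x_n)$ such that, for some $j\in\{1,\dots,n\}$, $x_i\in n\mathbb Z$ for all $i\ne j$ (so $X_1=\mathbb R$, $X_2=(\mathbb R\times2\mathbb Z)\cup(2\mathbb Z\times\mathbb R)$, $X_3=(\mathbb R\times3\mathbb Z\times3\mathbb Z)\cup(3\mathbb Z\times\mathbb R\times3\mathbb Z)\cup(3\mathbb Z\times3\mathbb Z\times\mathbb R)$, etc.). For $a=(a_1,\dots,a_l)\in X_l$ and $b=(b_1,\dots,b_k)\in X_k$ with $l\le k$, let $a'=(a_1,\dots,a_l,0,0,\dots)$ and $b'=(b_1,\dots,b_k,0,0,\dots)$ in $\bigoplus\mathbb R$ (finitely supported real sequences), let $c=0$ if $l=k$ and $c=l+(l+1)+\dots+(k-1)$ if $l<k$, and define $d(a,b)=d(b,a)=\max\{d_{\max}(a',b'),c\}$, where $d_{\max}$ is the maximum metric on $\bigoplus\mathbb R$. Then $X_{\omega+1}=(\bigsqcup_{n\ge1}X_n,d)$ (disjoint union). *)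

theory Defs
  imports
    "HOL-Analysis.Analysis"
    "HOL-Library.Extended"
    "HOL-Library.Infinite_Typeclass"
begin

section \<open>Ordinals\<close>

text \<open>
  An element of \<open>'k ordinal\<close> is the order type of a well-order carried by some subset of \<open>'k\<close>.
  The parameter \<open>'k\<close> only bounds the size of the available ordinals: \<open>nat ordinal\<close> consists of all
  countable ordinals, and larger types \<open>'k\<close> give longer initial segments of the class of all
  ordinals.
\<close>

quotient_type 'k ordinal = "'k rel" / partial: "\<lambda>r s :: 'k rel. (r, s) \<in> ordIso"
proof (rule part_equivpI)
  have "({} :: 'k rel, {} :: 'k rel) \<in> ordIso"
    by (rule ordIso_reflexive) (simp add: well_order_on_def linear_order_on_def partial_order_on_def preorder_on_def refl_on_def trans_def antisym_def total_on_def)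
  then show "\<exists>r :: 'k rel. (r, r) \<in> ordIso" ..
  show "symp (\<lambda>r s :: 'k rel. (r, s) \<in> ordIso)"
    by (auto intro!: sympI ordIso_symmetric)
  show "transp (\<lambda>r s :: 'k rel. (r, s) \<in> ordIso)"
    by (auto intro!: transpI elim: ordIso_transitive)
qed

lemma ordIso_self_iff: "(r, r) \<in> ordIso \<longleftrightarrow> Well_order r"
  using ordIso_reflexive by (auto simp: ordIso_def)

lemma ordinal_cases:
  obtains r where "(r, r) \<in> ordIso" "\<alpha> = abs_ordinal r"
  by (induct \<alpha> rule: ordinal.abs_induct) blast

instantiation ordinal :: (type) wellorder
begin

lift_definition less_eq_ordinal :: "'k ordinal \<Rightarrow> 'k ordinal \<Rightarrow> bool" is "\<lambda>r s. (r, s) \<in> ordLeq"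
  by (meson ordIso_ordLeq_trans ordIso_symmetric ordLeq_ordIso_trans)

lift_definition less_ordinal :: "'k ordinal \<Rightarrow> 'k ordinal \<Rightarrow> bool" is "\<lambda>r s. (r, s) \<in> ordLess"
  by (meson ordIso_ordLess_trans ordIso_symmetric ordLess_ordIso_trans)

instance
proof
  fix x y z :: "'k ordinal"
  show "x < y \<longleftrightarrow> x \<le> y \<and> \<not> y \<le> x"
    by transfer
      (metis not_ordLess_ordLeq not_ordLeq_iff_ordLess ordIso_self_iff ordLess_imp_ordLeq)
  show "x \<le> x"
    by transfer (simp add: ordIso_self_iff ordLeq_reflexive)
  show "x \<le> y \<Longrightarrow> y \<le> z \<Longrightarrow> x \<le> z"
    by transfer (rule ordLeq_transitive)
  show "x \<le> y \<Longrightarrow> y \<le> x \<Longrightarrow> x = y"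
    by transfer (simp add: ordIso_iff_ordLeq)
  show "x \<le> y \<or> y \<le> x"
    by transfer (simp add: ordIso_self_iff ordLeq_total)
next
  fix P :: "'k ordinal \<Rightarrow> bool" and a :: "'k ordinal"
  assume step: "\<And>x. (\<And>y. y < x \<Longrightarrow> P y) \<Longrightarrow> P x"
  have "\<forall>a. (r, r) \<in> ordIso \<longrightarrow> a = abs_ordinal r \<longrightarrow> P a" for r :: "'k rel"
  proof (induction r rule: wf_induct_rule[OF wf_ordLess])
    case (1 r)
    show ?case
    proof (intro allI impI)
      fix a assume r: "(r, r) \<in> ordIso" and a: "a = abs_ordinal r"
      show "P a"
      proof (rule step)
        fix b assume "b < a"
        obtain s where s: "(s, s) \<in> ordIso" "b = abs_ordinal s"
          by (rule ordinal_cases)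
        with \<open>b < a\<close> a r have "(s, r) \<in> ordLess"
          by (simp add: less_ordinal.abs_eq)
        then show "P b" using 1 s by blast
      qed
    qed
  qed
  then show "P a"
    by (metis ordinal_cases)
qed

end

instantiation ordinal :: (type) zero
begin

lift_definition zero_ordinal :: "'k ordinal" is "{}"
  by (rule ordIso_reflexive) (simp add: well_order_on_def linear_order_on_def partial_order_on_def preorder_on_def refl_on_def trans_def antisym_def total_on_def)

instance ..

end

lemma ordinal_zero_le [simp]: "0 \<le> (\<alpha> :: 'k ordinal)"
  by transfer (auto simp: ordLeq_def ordIso_self_iff embed_def bij_betw_def)

lemma ordinal_pos_iff: "0 < (\<alpha> :: 'k ordinal) \<longleftrightarrow> \<alpha> \<noteq> 0"
  using ordinal_zero_le[of \<alpha>] by (auto simp: less_le)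


lemma ordinal_no_top: "\<exists>\<beta>. (\<alpha> :: 'k::infinite ordinal) < \<beta>"
proof -
  obtain r :: "'k rel" where r: "(r, r) \<in> ordIso" "\<alpha> = abs_ordinal r"
    by (rule ordinal_cases)
  then have wr: "Well_order r"
    by (simp add: ordIso_self_iff)
  fix x :: 'k
  obtain f :: "'k \<Rightarrow> 'k" where f: "bij_betw f UNIV (UNIV - {x})"
    using infinite_imp_bij_betw[OF infinite_UNIV] by blast
  define s where "s = dir_image r f"
  have inj: "inj_on f (Field r)"
    using f by (auto simp: bij_betw_def intro: inj_on_subset)
  have rs: "(r, s) \<in> ordIso"
    unfolding s_def by (rule dir_image_ordIso[OF wr inj])
  have ws: "Well_order s"
    unfolding s_def by (rule Well_order_dir_image[OF wr inj])
  have x: "x \<notin> Field s"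
    using f by (auto simp: s_def dir_image_Field bij_betw_def)
  define t where "t = s \<union> (insert x (Field s)) \<times> {x}"
  have Ft: "Field t = insert x (Field s)"
    by (auto simp: t_def Field_def)
  have "t - Id = (s - Id) \<union> (Field s \<times> {x})"
    using x by (auto simp: t_def)
  moreover have "wf ((s - Id) \<union> (Field s \<times> {x}))"
  proof (rule wf_Un)
    show "wf (s - Id)"
      using ws by (simp add: well_order_on_def)
    show "wf (Field s \<times> {x})"
      by (rule wf_no_loop) (use x in auto)
    show "Domain (s - Id) \<inter> Range (Field s \<times> {x}) = {}"
      using x by (auto simp: Field_def)
  qed
  moreover have "Linear_order t"
  proof -
    have mem: "a \<in> Field s" "b \<in> Field s" if "(a, b) \<in> s" for a b
      using that by (auto simp: Field_def)
    have rfl: "(a, a) \<in> s" if "a \<in> Field s" for a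
      using ws that by (auto simp: order_on_defs refl_on_def)
    have "refl_on (Field t) t"
      unfolding Ft by (auto simp: refl_on_def t_def rfl)
    moreover have "t \<subseteq> Field t \<times> Field t"
      unfolding Ft by (auto simp: t_def mem)
    moreover have "trans t"
    proof (rule transI)
      fix a b c assume "(a, b) \<in> t" "(b, c) \<in> t"
      moreover have "trans s"
        using ws by (simp add: order_on_defs)
      ultimately show "(a, c) \<in> t"
        using x mem unfolding t_def by (auto dest: transD)
    qed
    moreover have "antisym t"
    proof (rule antisymI)
      fix a b assume "(a, b) \<in> t" "(b, a) \<in> t"
      moreover have "antisym s"
        using ws by (simp add: order_on_defs)
      ultimately show "a = b"
        using x mem unfolding t_def by (auto dest: antisymD)
    qed
    moreover have "total_on (Field t) t"
    proof -
      have "total_on (Field s) s"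
        using ws by (simp add: order_on_defs)
      then show ?thesis
        unfolding Ft by (auto simp: total_on_def t_def)
    qed
    ultimately show ?thesis
      by (simp add: order_on_defs)
  qed
  ultimately have wt: "Well_order t"
    by (simp add: well_order_on_def)
  have "Restr t (Field s) = s"
    using x by (auto simp: t_def Field_def)
  moreover have "wo_rel.ofilter t (Field s)"
    using wt x Ft by (auto simp: wo_rel.ofilter_def wo_rel_def under_def t_def Field_def)
  ultimately have "(s, t) \<in> ordLess"
    using ofilter_ordLess[OF wt, of "Field s"] x Ft by auto
  with rs have "(r, t) \<in> ordLess"
    by (rule ordIso_ordLess_trans)
  then have "\<alpha> < abs_ordinal t"
    using r wt by (simp add: less_ordinal.abs_eq ordIso_self_iff)
  then show ?thesis ..
qed

instance ordinal :: (infinite) no_top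
  by standard (rule ordinal_no_top)

lemma ex_infinite_ordinal: "\<exists>\<alpha> :: 'k::infinite ordinal. infinite {..<\<alpha>}"
proof -
  obtain r :: "'k rel" where "well_order_on UNIV r"
    using well_order_on by blast
  then have wr: "Well_order r" and F: "Field r = UNIV"
    using well_order_on_Well_order by auto
  define g where "g a = abs_ordinal (Restr r (underS r a))" for a
  have wR: "Well_order (Restr r A)" for A
    by (rule Well_order_Restr[OF wr])
  have of: "wo_rel.ofilter r (underS r a)" for a
    using wr by (simp add: wo_rel.underS_ofilter wo_rel_def)
  have lt: "g a < g b" if "(a, b) \<in> r" "a \<noteq> b" for a b
  proof -
    have "underS r a \<subset> underS r b"
    proof
      show "underS r a \<subseteq> underS r b"
        using that wr
        unfolding well_order_on_def linear_order_on_def partial_order_on_def preorder_on_def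
          trans_def antisym_def underS_def
        by blast
      show "underS r a \<noteq> underS r b"
        using that by (auto simp: underS_def)
    qed
    then have "(Restr r (underS r a), Restr r (underS r b)) \<in> ordLess"
      using ofilter_subset_ordLess[OF wr of of] by blast
    then show ?thesis
      unfolding g_def using wR by (simp add: less_ordinal.abs_eq ordIso_self_iff)
  qed
  have "inj g"
  proof (rule injI, rule ccontr)
    fix a b assume "g a = g b" "a \<noteq> b"
    moreover have "(a, b) \<in> r \<or> (b, a) \<in> r"
      using wr \<open>a \<noteq> b\<close> F by (auto simp: well_order_on_def linear_order_on_def total_on_def)
    ultimately show False
      using lt by fastforce
  qed
  then have "infinite (range g)"
    using infinite_UNIV finite_imageD by blast
  moreover have "range g \<subseteq> {..<abs_ordinal r}"
  proof clarsimp
    fix a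
    have "(Restr r (underS r a), r) \<in> ordLess"
      using underS_Restr_ordLess[OF wr, of a] F by auto
    then show "g a < abs_ordinal r"
      unfolding g_def using wR wr by (simp add: less_ordinal.abs_eq ordIso_self_iff)
  qed
  ultimately show ?thesis
    using finite_subset by blast
qed

definition osuc :: "'k::infinite ordinal \<Rightarrow> 'k ordinal"
  where "osuc \<alpha> = (LEAST \<beta>. \<alpha> < \<beta>)"

definition omega :: "'k::infinite ordinal"
  where "omega = (LEAST \<alpha>. infinite {..<\<alpha>})"

lemma less_osuc [simp]: "\<alpha> < osuc \<alpha>"
  unfolding osuc_def by (rule LeastI_ex) (rule gt_ex)

lemma less_osuc_iff: "\<beta> < osuc \<alpha> \<longleftrightarrow> \<beta> \<le> \<alpha>"
  using less_osuc[of \<alpha>] not_less_Least[of \<beta> "\<lambda>\<beta>. \<alpha> < \<beta>"]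
  by (metis le_less_trans not_le osuc_def)

lemma osuc_inject [simp]: "osuc \<alpha> = osuc \<beta> \<longleftrightarrow> \<alpha> = \<beta>"
  by (metis less_osuc less_osuc_iff antisym)

definition limit_or_zero :: "'k::infinite ordinal \<Rightarrow> bool"
  where "limit_or_zero \<alpha> \<longleftrightarrow> (\<nexists>\<beta>. \<alpha> = osuc \<beta>)"

text \<open>
  For a natural number \<open>n\<close>, the ordinal \<open>\<alpha> + n\<close> is the \<open>n\<close>-th successor \<open>(osuc ^^ n) \<alpha>\<close>.
\<close>

lemma limit_decomposition_exists: "\<exists>l n. limit_or_zero l \<and> \<gamma> = (osuc ^^ n) l"
proof (induction \<gamma> rule: less_induct)
  case (less \<gamma>)
  show ?case
  proof (cases "limit_or_zero \<gamma>")
    case True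
    then show ?thesis by (intro exI[of _ \<gamma>] exI[of _ 0]) simp
  next
    case False
    then obtain \<beta> where \<beta>: "\<gamma> = osuc \<beta>"
      by (auto simp: limit_or_zero_def)
    with less.IH[of \<beta>] obtain l n where "limit_or_zero l" "\<beta> = (osuc ^^ n) l"
      by auto
    with \<beta> show ?thesis by (intro exI[of _ l] exI[of _ "Suc n"]) simp
  qed
qed

lemma limit_decomposition_unique:
  assumes "limit_or_zero l" "limit_or_zero l'" "(osuc ^^ n) l = (osuc ^^ m) l'"
  shows "l = l' \<and> n = m"
  using assms(3)
proof (induction n arbitrary: m)
  case 0
  then show ?case using assms(1,2) by (cases m) (auto simp: limit_or_zero_def)
next
  case (Suc n)
  then show ?case using assms(1,2) by (cases m) (auto simp: limit_or_zero_def)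
qed

definition limit_part :: "'k::infinite ordinal \<Rightarrow> 'k ordinal"
  where "limit_part \<gamma> = (THE l. limit_or_zero l \<and> (\<exists>n. \<gamma> = (osuc ^^ n) l))"

definition finite_part :: "'k::infinite ordinal \<Rightarrow> nat"
  where "finite_part \<gamma> = (THE n. \<gamma> = (osuc ^^ n) (limit_part \<gamma>))"

lemma limit_part_eq: "limit_or_zero l \<Longrightarrow> limit_part ((osuc ^^ n) l) = l"
  unfolding limit_part_def using limit_decomposition_unique by (intro the_equality) blast+

lemma finite_part_eq: "limit_or_zero l \<Longrightarrow> finite_part ((osuc ^^ n) l) = n"
  unfolding finite_part_def limit_part_eq using limit_decomposition_unique
  by (intro the_equality) (auto simp: limit_part_eq)

lemma limit_decomposition:
  "limit_or_zero (limit_part \<gamma>)" "\<gamma> = (osuc ^^ finite_part \<gamma>) (limit_part \<gamma>)"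
  using limit_decomposition_exists[of \<gamma>] by (auto simp: limit_part_eq finite_part_eq)


section \<open>Families of subsets\<close>

definition diam :: "('p \<Rightarrow> 'p \<Rightarrow> real) \<Rightarrow> 'p set \<Rightarrow> ennreal"
  where "diam d U = (SUP x\<in>U. SUP y\<in>U. ennreal (d x y))"

definition set_distance :: "('p \<Rightarrow> 'p \<Rightarrow> real) \<Rightarrow> 'p set \<Rightarrow> 'p set \<Rightarrow> ennreal"
  where "set_distance d U V = (INF x\<in>U. INF y\<in>V. ennreal (d x y))"

definition R_bounded :: "('p \<Rightarrow> 'p \<Rightarrow> real) \<Rightarrow> real \<Rightarrow> 'p set set \<Rightarrow> bool"
  where "R_bounded d R \<U> \<longleftrightarrow> (SUP U\<in>\<U>. diam d U) \<le> ennreal R"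

definition uniformly_bounded :: "('p \<Rightarrow> 'p \<Rightarrow> real) \<Rightarrow> 'p set set \<Rightarrow> bool"
  where "uniformly_bounded d \<U> \<longleftrightarrow> (\<exists>R>0. R_bounded d R \<U>)"

definition r_disjoint :: "('p \<Rightarrow> 'p \<Rightarrow> real) \<Rightarrow> real \<Rightarrow> 'p set set \<Rightarrow> bool"
  where "r_disjoint d r \<U> \<longleftrightarrow>
    (\<forall>U\<in>\<U>. \<forall>V\<in>\<U>. U \<noteq> V \<longrightarrow> ennreal r \<le> set_distance d U V)"

lemma r_disjoint_empty [simp]: "r_disjoint d r {}"
  by (simp add: r_disjoint_def)

lemma uniformly_bounded_empty [simp]: "uniformly_bounded d {}"
  unfolding uniformly_bounded_def R_bounded_def by (rule exI[of _ 1]) simp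


section \<open>Transfinite asymptotic dimension\<close>

definition FinN :: "nat set set"
  where "FinN = {\<sigma>. finite \<sigma> \<and> \<sigma> \<noteq> {} \<and> \<sigma> \<subseteq> {1..}}"

definition residual :: "nat set set \<Rightarrow> nat \<Rightarrow> nat set set"
  where "residual M a = {\<tau> \<in> FinN. \<tau> \<union> {a} \<in> M \<and> a \<notin> \<tau>}"

text \<open>
  \<open>Ord_le M \<alpha>\<close> is the relation \<open>Ord M \<le> \<alpha>\<close>; the ordinal decreases from conclusion to premises, so
  the least relation closed under the rules is the one defined by recursion on \<open>\<alpha>\<close>. In the second
  rule, \<open>Ord (residual M a) < \<alpha>\<close> is expressed by \<open>Ord (residual M a) \<le> \<beta>\<close> for some \<open>\<beta> < \<alpha>\<close>.
\<close>

inductive Ord_le :: "nat set set \<Rightarrow> 'k::infinite ordinal \<Rightarrow> bool" where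
  "Ord_le {} 0"
| "\<alpha> > 0 \<Longrightarrow> (\<And>a. a \<in> {1..} \<Longrightarrow> \<exists>\<beta><\<alpha>. Ord_le (residual M a) \<beta>) \<Longrightarrow> Ord_le M \<alpha>"

text \<open>Dimensions take values in the ordinals extended by \<open>-1\<close> (\<open>Minf\<close>) and \<open>\<infinity>\<close> (\<open>Pinf\<close>).\<close>

definition Ord :: "nat set set \<Rightarrow> 'k::infinite ordinal extended"
  where "Ord M = (if \<exists>\<alpha> :: 'k ordinal. Ord_le M \<alpha> then Fin (LEAST \<alpha>. Ord_le M \<alpha>) else Pinf)"

definition A_family :: "('p \<Rightarrow> 'p \<Rightarrow> real) \<Rightarrow> 'p set \<Rightarrow> nat set set"
  where "A_family d X = {\<sigma> \<in> FinN. \<not> (\<exists>\<U> :: nat \<Rightarrow> 'p set set.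
    (\<forall>i\<in>\<sigma>. \<U> i \<subseteq> Pow X \<and> uniformly_bounded d (\<U> i) \<and> r_disjoint d (real i) (\<U> i)) \<and>
    X \<subseteq> \<Union> (\<Union>i\<in>\<sigma>. \<U> i))}"

definition trasdim :: "('p \<Rightarrow> 'p \<Rightarrow> real) \<Rightarrow> 'p set \<Rightarrow> 'k::infinite ordinal extended"
  where "trasdim d X = Ord (A_family d X)"

lemma Ord_le_zero_iff: "Ord_le M (0 :: 'k::infinite ordinal) \<longleftrightarrow> M = {}"
  by (auto elim: Ord_le.cases intro: Ord_le.intros)

lemma Ord_le_pos_iff:
  "0 < \<alpha> \<Longrightarrow> Ord_le M \<alpha> \<longleftrightarrow> (\<forall>a\<in>{1..}. \<exists>\<beta><\<alpha>. Ord_le (residual M a) \<beta>)"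
  by (subst Ord_le.simps) auto

lemma residual_empty [simp]: "residual {} a = {}"
  by (simp add: residual_def)

lemma Ord_le_mono:
  assumes "Ord_le M \<alpha>" "\<alpha> \<le> \<beta>"
  shows "Ord_le M \<beta>"
proof (cases "\<beta> = \<alpha>")
  case False
  with assms have "\<alpha> < \<beta>" by simp
  then have "0 < \<beta>"
    using ordinal_zero_le[of \<alpha>] by (rule le_less_trans[rotated])
  moreover have "\<exists>\<delta><\<beta>. Ord_le (residual M a) \<delta>" if "a \<in> {1..}" for a
  proof (cases "\<alpha> = 0")
    case True
    then show ?thesis
      using assms(1) \<open>0 < \<beta>\<close> by (auto simp: Ord_le_zero_iff)
  next
    case False
    then show ?thesis
      using assms(1) \<open>\<alpha> < \<beta>\<close> that by (meson Ord_le_pos_iff less_trans ordinal_pos_iff)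
  qed
  ultimately show ?thesis
    by (simp add: Ord_le_pos_iff)
qed (use assms in simp)

lemma Ord_le_iff: "Ord M \<le> Fin \<alpha> \<longleftrightarrow> Ord_le M \<alpha>"
proof (cases "\<exists>\<alpha> :: 'a ordinal. Ord_le M \<alpha>")
  case True
  then have "Ord_le M (LEAST \<alpha> :: 'a ordinal. Ord_le M \<alpha>)"
    by (rule LeastI_ex)
  then have "(LEAST \<alpha>. Ord_le M \<alpha>) \<le> \<alpha> \<longleftrightarrow> Ord_le M \<alpha>"
    using Ord_le_mono Least_le[of "Ord_le M" \<alpha>] by blast
  with True show ?thesis
    by (simp only: Ord_def if_True less_eq_extended.simps)
qed (auto simp: Ord_def)

lemma Ord_less_iff: "Ord M < Fin \<alpha> \<longleftrightarrow> (\<exists>\<beta><\<alpha>. Ord_le M \<beta>)"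
proof (cases "\<exists>\<alpha> :: 'a ordinal. Ord_le M \<alpha>")
  case True
  then have "Ord_le M (LEAST \<alpha> :: 'a ordinal. Ord_le M \<alpha>)"
    by (rule LeastI_ex)
  then have "(LEAST \<alpha>. Ord_le M \<alpha>) < \<alpha> \<longleftrightarrow> (\<exists>\<beta><\<alpha>. Ord_le M \<beta>)"
    using Least_le[of "Ord_le M"] le_less_trans by blast
  with True show ?thesis
    by (simp only: Ord_def if_True less_extended_simps)
qed (auto simp: Ord_def)

lemma Ord_eq_zero_iff: "Ord M = Fin (0 :: 'k::infinite ordinal) \<longleftrightarrow> M = {}"
proof -
  have "Ord M = Fin (0 :: 'k ordinal) \<longleftrightarrow> Ord M \<le> Fin (0 :: 'k ordinal)"
    by (auto simp: Ord_def antisym)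
  then show ?thesis
    by (simp add: Ord_le_iff Ord_le_zero_iff)
qed

lemma Ord_le_Fin_iff:
  "0 < \<alpha> \<Longrightarrow> Ord M \<le> Fin \<alpha> \<longleftrightarrow> (\<forall>a\<in>{1..}. Ord (residual M a) < Fin \<alpha>)"
  by (simp add: Ord_le_iff Ord_less_iff Ord_le_pos_iff)


section \<open>Complementary-finite asymptotic dimension\<close>

text \<open>
  \<open>coasdim_le d X \<gamma>\<close> is the relation \<open>coasdim X \<le> \<gamma>\<close>. Its recursive condition
  \<open>coasdim Y < limit_part \<gamma>\<close> is expressed by: \<open>Y = {}\<close> (value \<open>-1\<close>), or \<open>coasdim Y \<le> \<beta>\<close> for some
  \<open>\<beta> < limit_part \<gamma>\<close>.
\<close>

inductive coasdim_le :: "('p \<Rightarrow> 'p \<Rightarrow> real) \<Rightarrow> 'p set \<Rightarrow> 'k::infinite ordinal \<Rightarrow> bool"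
  for d :: "'p \<Rightarrow> 'p \<Rightarrow> real" where
  "(\<And>r::real. r > 0 \<Longrightarrow> \<exists>\<U> :: nat \<Rightarrow> 'p set set.
      (\<forall>i\<le>finite_part \<gamma>.
        \<U> i \<subseteq> Pow X \<and> r_disjoint d r (\<U> i) \<and> uniformly_bounded d (\<U> i)) \<and>
      (X - \<Union> (\<Union>i\<le>finite_part \<gamma>. \<U> i) = {} \<or>
       (\<exists>\<beta><limit_part \<gamma>. coasdim_le d (X - \<Union> (\<Union>i\<le>finite_part \<gamma>. \<U> i)) \<beta>)))
    \<Longrightarrow> coasdim_le d X \<gamma>"

definition coasdim :: "('p \<Rightarrow> 'p \<Rightarrow> real) \<Rightarrow> 'p set \<Rightarrow> 'k::infinite ordinal extended"
  where "coasdim d X =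
    (if X = {} then Minf
     else if \<exists>\<gamma> :: 'k ordinal. coasdim_le d X \<gamma> then Fin (LEAST \<gamma>. coasdim_le d X \<gamma>)
     else Pinf)"

lemma coasdim_le_empty: "coasdim_le d {} \<gamma>"
  by (rule coasdim_le.intros, rule exI[of _ "\<lambda>_. {}"]) simp

lemma le_osuc_funpow: "\<alpha> \<le> (osuc ^^ n) \<alpha>"
  by (induction n) (auto intro: less_imp_le[OF le_less_trans[OF _ less_osuc]])

lemma limit_part_dichotomy:
  assumes "\<gamma> < \<gamma>'"
  shows "\<gamma> < limit_part \<gamma>' \<or> limit_part \<gamma> = limit_part \<gamma>' \<and> finite_part \<gamma> \<le> finite_part \<gamma>'"
proof -
  have "\<gamma> < l \<or> (\<exists>m\<le>n. \<gamma> = (osuc ^^ m) l)" if "\<gamma> \<le> (osuc ^^ n) l" for n and l :: "'a ordinal"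
    using that
  proof (induction n)
    case (Suc n)
    show ?case
    proof (cases "\<gamma> = (osuc ^^ Suc n) l")
      case False
      with Suc.prems have "\<gamma> < osuc ((osuc ^^ n) l)"
        by simp
      with Suc.IH show ?thesis
        by (auto simp: less_osuc_iff intro: le_SucI)
    qed blast
  qed (auto simp: less_le)
  from this[where n = "finite_part \<gamma>'" and l = "limit_part \<gamma>'"] assms
  consider "\<gamma> < limit_part \<gamma>'"
    | m where "m \<le> finite_part \<gamma>'" "\<gamma> = (osuc ^^ m) (limit_part \<gamma>')"
    using limit_decomposition(2)[of \<gamma>'] by (metis less_imp_le)
  then show ?thesis
  proof cases
    case 2
    with limit_decomposition(1)[of \<gamma>'] show ?thesis
      by (simp add: limit_part_eq finite_part_eq)
  qed simp
qed

lemma coasdim_le_mono: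
  assumes "coasdim_le d X \<gamma>" "\<gamma> \<le> \<gamma>'"
  shows "coasdim_le d X \<gamma>'"
proof (cases "\<gamma> = \<gamma>'")
  case False
  with assms have "\<gamma> < \<gamma>'" by simp
  then consider "\<gamma> < limit_part \<gamma>'"
    | "limit_part \<gamma> = limit_part \<gamma>'" "finite_part \<gamma> \<le> finite_part \<gamma>'"
    using limit_part_dichotomy by blast
  then show ?thesis
  proof cases
    case 1
    show ?thesis
      by (rule coasdim_le.intros, rule exI[of _ "\<lambda>_. {}"]) (use 1 assms(1) in simp, blast)
  next
    case 2
    show ?thesis
    proof (rule coasdim_le.intros)
      fix r :: real assume "r > 0"
      from assms(1) have "\<exists>\<U>. (\<forall>i\<le>finite_part \<gamma>.
          \<U> i \<subseteq> Pow X \<and> r_disjoint d r (\<U> i) \<and> uniformly_bounded d (\<U> i)) \<and>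
        (X - \<Union> (\<Union>i\<le>finite_part \<gamma>. \<U> i) = {} \<or>
         (\<exists>\<beta><limit_part \<gamma>. coasdim_le d (X - \<Union> (\<Union>i\<le>finite_part \<gamma>. \<U> i)) \<beta>))"
      proof cases
        case 1
        from 1[OF \<open>r > 0\<close>] show ?thesis .
      qed
      then obtain \<U> :: "nat \<Rightarrow> 'a set set" where \<U>:
        "\<forall>i\<le>finite_part \<gamma>.
          \<U> i \<subseteq> Pow X \<and> r_disjoint d r (\<U> i) \<and> uniformly_bounded d (\<U> i)"
        "X - \<Union> (\<Union>i\<le>finite_part \<gamma>. \<U> i) = {} \<or>
          (\<exists>\<beta><limit_part \<gamma>. coasdim_le d (X - \<Union> (\<Union>i\<le>finite_part \<gamma>. \<U> i)) \<beta>)"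
        by (elim exE conjE)
      define \<V> where "\<V> i = (if i \<le> finite_part \<gamma> then \<U> i else {})" for i
      have eq: "(\<Union>i\<le>finite_part \<gamma>'. \<V> i) = (\<Union>i\<le>finite_part \<gamma>. \<U> i)"
      proof (intro equalityI subsetI)
        fix U assume "U \<in> (\<Union>i\<le>finite_part \<gamma>. \<U> i)"
        then obtain i where "i \<le> finite_part \<gamma>" "U \<in> \<U> i" by blast
        then have "i \<le> finite_part \<gamma>'" "U \<in> \<V> i"
          using 2(2) by (auto simp: \<V>_def)
        then show "U \<in> (\<Union>i\<le>finite_part \<gamma>'. \<V> i)" by blast
      qed (auto simp: \<V>_def split: if_splits)
      show "\<exists>\<U>. (\<forall>i\<le>finite_part \<gamma>'.
          \<U> i \<subseteq> Pow X \<and> r_disjoint d r (\<U> i) \<and> uniformly_bounded d (\<U> i)) \<and>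
        (X - \<Union> (\<Union>i\<le>finite_part \<gamma>'. \<U> i) = {} \<or>
         (\<exists>\<beta><limit_part \<gamma>'. coasdim_le d (X - \<Union> (\<Union>i\<le>finite_part \<gamma>'. \<U> i)) \<beta>))"
      proof (rule exI[of _ \<V>], intro conjI)
        show "\<forall>i\<le>finite_part \<gamma>'.
          \<V> i \<subseteq> Pow X \<and> r_disjoint d r (\<V> i) \<and> uniformly_bounded d (\<V> i)"
          using \<U>(1) by (auto simp: \<V>_def)
        show "X - \<Union> (\<Union>i\<le>finite_part \<gamma>'. \<V> i) = {} \<or>
         (\<exists>\<beta><limit_part \<gamma>'. coasdim_le d (X - \<Union> (\<Union>i\<le>finite_part \<gamma>'. \<V> i)) \<beta>)"
          using \<U>(2) unfolding eq 2(1) .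
      qed
    qed
  qed
qed (use assms in simp)

lemma coasdim_le_iff:
  fixes \<gamma> :: "'b::infinite ordinal"
  shows "coasdim d X \<le> Fin \<gamma> \<longleftrightarrow> coasdim_le d X \<gamma>"
proof (cases "X \<noteq> {} \<and> (\<exists>\<delta> :: 'b ordinal. coasdim_le d X \<delta>)")
  case True
  then have "coasdim_le d X (LEAST \<delta> :: 'b ordinal. coasdim_le d X \<delta>)"
    by (blast intro: LeastI_ex)
  then have "(LEAST \<gamma>. coasdim_le d X \<gamma>) \<le> \<gamma> \<longleftrightarrow> coasdim_le d X \<gamma>"
    using coasdim_le_mono Least_le[of "coasdim_le d X" \<gamma>] by blast
  with True show ?thesis
    by (simp only: coasdim_def if_True if_False less_eq_extended.simps simp_thms)
qed (auto simp: coasdim_def coasdim_le_empty)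

lemma coasdim_less_iff:
  fixes \<gamma> :: "'b::infinite ordinal"
  shows "coasdim d X < Fin \<gamma> \<longleftrightarrow> X = {} \<or> (\<exists>\<beta><\<gamma>. coasdim_le d X \<beta>)"
proof (cases "X \<noteq> {} \<and> (\<exists>\<delta> :: 'b ordinal. coasdim_le d X \<delta>)")
  case True
  then have "coasdim_le d X (LEAST \<delta> :: 'b ordinal. coasdim_le d X \<delta>)"
    by (blast intro: LeastI_ex)
  then have "(LEAST \<gamma>. coasdim_le d X \<gamma>) < \<gamma> \<longleftrightarrow> (\<exists>\<beta><\<gamma>. coasdim_le d X \<beta>)"
    using Least_le[of "coasdim_le d X"] le_less_trans by blast
  with True show ?thesis
    by (simp only: coasdim_def if_True if_False less_extended_simps simp_thms)
qed (auto simp: coasdim_def)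

lemma coasdim_le_Fin_iff:
  "coasdim d X \<le> Fin \<gamma> \<longleftrightarrow>
    (\<forall>r>0. \<exists>\<U> :: nat \<Rightarrow> 'p set set.
      (\<forall>i\<le>finite_part \<gamma>.
        \<U> i \<subseteq> Pow X \<and> r_disjoint d r (\<U> i) \<and> uniformly_bounded d (\<U> i)) \<and>
      coasdim d (X - \<Union> (\<Union>i\<le>finite_part \<gamma>. \<U> i)) < Fin (limit_part \<gamma>))"
  for d :: "'p \<Rightarrow> 'p \<Rightarrow> real"
  unfolding coasdim_le_iff coasdim_less_iff by (subst coasdim_le.simps) auto


section \<open>The space \<open>X_omega1\<close>\<close>

text \<open>
  A point of \<open>\<real>\<^sup>n\<close> is a list of length \<open>n\<close>, so that the sets \<open>X_piece n\<close> are pairwise disjoint and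
  their disjoint union is a plain union. Coordinates are indexed from \<open>0\<close>.
\<close>

definition X_piece :: "nat \<Rightarrow> real list set"
  where "X_piece n = {x. length x = n \<and>
    (\<exists>j<n. \<forall>i<n. i \<noteq> j \<longrightarrow> (\<exists>k::int. x ! i = real n * of_int k))}"

definition X_omega1 :: "real list set"
  where "X_omega1 = (\<Union>n\<in>{1..}. X_piece n)"

definition pad :: "real list \<Rightarrow> nat \<Rightarrow> real"
  where "pad x i = (if i < length x then x ! i else 0)"

definition d_max :: "(nat \<Rightarrow> real) \<Rightarrow> (nat \<Rightarrow> real) \<Rightarrow> real"
  where "d_max f g = (SUP i. \<bar>f i - g i\<bar>)"

definition level_gap :: "nat \<Rightarrow> nat \<Rightarrow> nat"
  where "level_gap l k = (\<Sum>i = min l k..<max l k. i)"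

definition d_omega1 :: "real list \<Rightarrow> real list \<Rightarrow> real"
  where "d_omega1 a b =
    max (d_max (pad a) (pad b)) (real (level_gap (length a) (length b)))"

lemma bdd_above_pad: "bdd_above (range (\<lambda>i. \<bar>pad a i - pad b i\<bar>))"
proof -
  have "finite ((\<lambda>i. \<bar>pad a i - pad b i\<bar>) ` {..<length a + length b})"
    by simp
  moreover have "range (\<lambda>i. \<bar>pad a i - pad b i\<bar>) \<subseteq>
      insert 0 ((\<lambda>i. \<bar>pad a i - pad b i\<bar>) ` {..<length a + length b})"
  proof (rule image_subsetI)
    fix i
    show "\<bar>pad a i - pad b i\<bar> \<in> insert 0 ((\<lambda>i. \<bar>pad a i - pad b i\<bar>) ` {..<length a + length b})"
      by (cases "i < length a + length b") (auto simp: pad_def)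
  qed
  ultimately show ?thesis
    by (meson bdd_above_finite finite.insertI finite_subset)
qed

lemma d_max_pad_upper: "\<bar>pad a i - pad b i\<bar> \<le> d_max (pad a) (pad b)"
  unfolding d_max_def by (rule cSUP_upper[OF UNIV_I bdd_above_pad])

lemma level_gap_triangle: "level_gap l m \<le> level_gap l k + level_gap k m"
proof -
  let ?A = "{min l k..<max l k}" and ?B = "{min k m..<max k m}"
  have "{min l m..<max l m} \<subseteq> ?A \<union> ?B"
    by (rule subsetI) (simp, linarith)
  then have "level_gap l m \<le> \<Sum>(?A \<union> ?B)"
    unfolding level_gap_def by (intro sum_mono2) auto
  also have "\<dots> \<le> \<Sum>?A + \<Sum>?B"
    by (subst sum_Un_nat) (rule finite_atLeastLessThan diff_le_self)+
  also have "\<dots> = level_gap l k + level_gap k m"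
    by (simp only: level_gap_def)
  finally show ?thesis .
qed

lemma level_gap_eq_0_iff: "1 \<le> l \<Longrightarrow> 1 \<le> k \<Longrightarrow> level_gap l k = 0 \<longleftrightarrow> l = k"
proof
  assume "1 \<le> l" "1 \<le> k" "level_gap l k = 0"
  then have "\<forall>i\<in>{min l k..<max l k}. i = 0"
    by (simp add: level_gap_def)
  then have "\<not> min l k < max l k"
    using \<open>1 \<le> l\<close> \<open>1 \<le> k\<close> by (auto dest: bspec[of _ _ "min l k"])
  then show "l = k"
    by linarith
qed (simp add: level_gap_def)

lemma Metric_space_X_omega1: "Metric_space X_omega1 d_omega1"
proof
  fix x y z
  show "0 \<le> d_omega1 x y"
    by (simp add: d_omega1_def le_max_iff_disj)
  show "d_omega1 x y = d_omega1 y x"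
    by (simp add: d_omega1_def d_max_def level_gap_def abs_minus_commute min.commute max.commute)
  show "d_omega1 x y = 0 \<longleftrightarrow> x = y" if "x \<in> X_omega1" "y \<in> X_omega1"
  proof
    assume 0: "d_omega1 x y = 0"
    then have "real (level_gap (length x) (length y)) \<le> 0"
      unfolding d_omega1_def by linarith
    then have "level_gap (length x) (length y) = 0"
      by simp
    with that have len: "length x = length y"
      by (subst (asm) level_gap_eq_0_iff) (auto simp: X_omega1_def X_piece_def)
    from 0 have le: "d_max (pad x) (pad y) \<le> 0"
      unfolding d_omega1_def by linarith
    show "x = y"
    proof (rule nth_equalityI[OF len])
      fix i assume "i < length x"
      with len d_max_pad_upper[of x i y] le show "x ! i = y ! i"
        by (simp add: pad_def)
    qed
  next
    assume "x = y"
    then show "d_omega1 x y = 0"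
      by (simp add: d_omega1_def d_max_def level_gap_def)
  qed
  show "d_omega1 x z \<le> d_omega1 x y + d_omega1 y z"
  proof -
    have "d_max (pad x) (pad z) \<le> d_max (pad x) (pad y) + d_max (pad y) (pad z)"
      unfolding d_max_def[of "pad x" "pad z"]
    proof (rule cSUP_least)
      fix i
      show "\<bar>pad x i - pad z i\<bar> \<le> d_max (pad x) (pad y) + d_max (pad y) (pad z)"
        using d_max_pad_upper[of x i y] d_max_pad_upper[of y i z] by linarith
    qed simp
    moreover have "real (level_gap (length x) (length z)) \<le>
        real (level_gap (length x) (length y)) + real (level_gap (length y) (length z))"
      using level_gap_triangle by (simp flip: of_nat_add)
    ultimately show ?thesis
      unfolding d_omega1_def by (intro max.boundedI) linarith+
  qed
qed

end

theory Submission
  imports Defs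
begin

text \<open>
  Upper bound: given \<open>r\<close>, round the coordinates of a point of \<open>X_m\<close>, \<open>m \<ge> 4 r\<close>, to multiples of a step
  \<open>L \<in> [2 r, 4 r]\<close> with \<open>m\<close> an even multiple of \<open>L\<close>. At most one rounded coordinate is an odd
  multiple, so that the cells without and those with an odd coordinate form two \<open>r\<close>-disjoint
  families. They leave out only finitely many pieces \<open>X_m\<close>, on which a fixed number of families
  (one for each parity vector) suffices at every scale.

  Lower bound: if the value were at most \<open>\<omega>\<close>, there would be an \<open>m\<close> such that a \<open>2\<close>-disjoint family
  together with \<open>m + 1\<close> families of arbitrarily large disjointness covers the space. On the vertices
  of \<open>X_n\<close>, \<open>n = m + 2\<close>, this gives a colouring by \<open>n\<close> colours with bounded classes, which contradicts
  a discrete form of Lebesgue's covering theorem. The \<open>2\<close>-disjoint family counts as only one colour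
  although \<open>2 < n\<close>, because its members cannot be separated along the edges of \<open>X_n\<close>.
\<close>

section \<open>Ordinals up to \<open>\<omega> + 1\<close>\<close>

lemma lessThan_osuc: "{..<osuc \<alpha>} = insert \<alpha> {..<\<alpha>}"
  by (auto simp: less_osuc_iff)

lemma infinite_lessThan_omega: "infinite {..<(omega :: 'k::infinite ordinal)}"
  unfolding omega_def using ex_infinite_ordinal by (rule LeastI_ex)

lemma less_omega_iff_finite: "\<beta> < (omega :: 'k::infinite ordinal) \<longleftrightarrow> finite {..<\<beta>}"
proof
  show "\<beta> < omega \<Longrightarrow> finite {..<\<beta>}"
    unfolding omega_def by (metis not_less_Least)
  show "finite {..<\<beta>} \<Longrightarrow> \<beta> < omega"
    by (metis finite_subset infinite_lessThan_omega lessThan_subset_iff not_le)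
qed

text \<open>A predecessor of \<open>omega\<close> would have only finitely many ordinals below it,
  and adding the predecessor itself would leave \<open>omega\<close> with finitely many too.\<close>

lemma limit_or_zero_omega: "limit_or_zero (omega :: 'k::infinite ordinal)"
  unfolding limit_or_zero_def
  by (metis finite_insert infinite_lessThan_omega less_omega_iff_finite less_osuc lessThan_osuc)

lemma limit_or_zero_0: "limit_or_zero (0 :: 'k::infinite ordinal)"
  unfolding limit_or_zero_def by (metis leD less_osuc ordinal_zero_le)

lemma less_omega_iff: "\<beta> < (omega :: 'k::infinite ordinal) \<longleftrightarrow> (\<exists>m. \<beta> = (osuc ^^ m) 0)"
proof
  assume "\<beta> < omega"
  define l where "l = limit_part \<beta>"
  have l: "limit_or_zero l" "\<beta> = (osuc ^^ finite_part \<beta>) l"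
    unfolding l_def by (rule limit_decomposition)+
  have "l \<le> \<beta>"
    using l(2) le_osuc_funpow by metis
  then have fin: "finite {..<l}"
    using \<open>\<beta> < omega\<close> by (meson le_less_trans less_omega_iff_finite)
  \<comment> \<open>A nonzero \<open>l\<close> with finitely many predecessors is the successor of
    the largest of them, hence no limit.\<close>
  have "l = 0"
  proof (rule ccontr)
    assume "l \<noteq> 0"
    then have ne: "{..<l} \<noteq> {}"
      using ordinal_pos_iff by blast
    define \<mu> where "\<mu> = Max {..<l}"
    have "\<mu> < l"
      using Max_in[OF fin ne] by (simp add: \<mu>_def)
    moreover have "\<not> osuc \<mu> < l"
    proof
      assume "osuc \<mu> < l"
      then have "osuc \<mu> \<le> \<mu>"
        unfolding \<mu>_def using fin by (intro Max_ge) auto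
      then show False
        by (meson leD less_osuc)
    qed
    ultimately have "l = osuc \<mu>"
      by (metis antisym less_osuc_iff not_le)
    then show False
      using l(1) by (auto simp: limit_or_zero_def)
  qed
  then show "\<exists>m. \<beta> = (osuc ^^ m) 0"
    using l(2) by blast
next
  have "finite {..<(osuc ^^ m) (0 :: 'k ordinal)}" for m
  proof (induction m)
    case 0
    have "{..<(0 :: 'k ordinal)} = {}"
      using ordinal_zero_le leD by blast
    then show ?case
      by simp
  qed (simp add: lessThan_osuc)
  then show "\<exists>m. \<beta> = (osuc ^^ m) 0 \<Longrightarrow> \<beta> < omega"
    by (auto simp: less_omega_iff_finite)
qed

lemma omega_pos: "0 < (omega :: 'k::infinite ordinal)"
  unfolding less_omega_iff by (rule exI[of _ 0]) simp

lemma osuc_pos: "0 < osuc (\<alpha> :: 'k::infinite ordinal)"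
  by (meson le_less_trans less_osuc ordinal_zero_le)


section \<open>Finite values of the two dimensions\<close>

lemma residual_subset_FinN: "residual M a \<subseteq> FinN"
  by (auto simp: residual_def)

lemma Ord_le_osuc_iff:
  "Ord_le M (osuc \<alpha>) \<longleftrightarrow> (\<forall>a\<in>{1..}. Ord_le (residual M a) \<alpha>)"
proof -
  have "(\<exists>\<beta><osuc \<alpha>. Ord_le N \<beta>) \<longleftrightarrow> Ord_le N \<alpha>" for N
    using Ord_le_mono[of N _ \<alpha>] less_osuc[of \<alpha>] by (auto simp: less_osuc_iff)
  then show ?thesis
    by (simp only: Ord_le_pos_iff[OF osuc_pos])
qed

text \<open>Each successor step pays for one residual, that is, for deleting one element.
  \<open>M \<subseteq> FinN\<close> excludes the empty set, so that for \<open>m = 0\<close> the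
  bound on cardinalities means \<open>M = {}\<close>.\<close>

lemma Ord_le_finite_iff:
  assumes "M \<subseteq> FinN"
  shows "Ord_le M ((osuc ^^ m) (0 :: 'k::infinite ordinal)) \<longleftrightarrow> (\<forall>\<tau>\<in>M. card \<tau> \<le> m)"
  using assms
proof (induction m arbitrary: M)
  case 0
  then have "card \<tau> > 0" if "\<tau> \<in> M" for \<tau>
    using that by (auto simp: FinN_def card_gt_0_iff)
  then show ?case
    by (fastforce simp: Ord_le_zero_iff)
next
  case (Suc m)
  have "Ord_le M (osuc ((osuc ^^ m) (0 :: 'k ordinal))) \<longleftrightarrow>
      (\<forall>a\<in>{1..}. Ord_le (residual M a) ((osuc ^^ m) (0 :: 'k ordinal)))"
    by (simp only: Ord_le_osuc_iff)
  also have "\<dots> \<longleftrightarrow> (\<forall>a\<in>{1..}. \<forall>\<tau>\<in>residual M a. card \<tau> \<le> m)"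
    by (simp only: Suc.IH[OF residual_subset_FinN])
  also have "\<dots> \<longleftrightarrow> (\<forall>\<tau>\<in>M. card \<tau> \<le> Suc m)"
  proof (intro iffI ballI)
    fix \<tau> assume *: "\<forall>a\<in>{1..}. \<forall>\<tau>\<in>residual M a. card \<tau> \<le> m" and "\<tau> \<in> M"
    then have \<tau>: "finite \<tau>" "\<tau> \<noteq> {}" "\<tau> \<subseteq> {1..}"
      using Suc.prems by (auto simp: FinN_def)
    then obtain a where a: "a \<in> \<tau>"
      by blast
    show "card \<tau> \<le> Suc m"
    \<comment> \<open>Residuals contain nonempty sets only, so a singleton has to be treated
      directly.\<close>
    proof (cases "\<tau> - {a} = {}")
      case True
      then have "card \<tau> \<le> card {a}"
        by (intro card_mono) auto
      then show ?thesis
        by simp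
    next
      case False
      have "\<tau> - {a} \<in> residual M a"
        using \<tau> False \<open>\<tau> \<in> M\<close> a by (auto simp: residual_def FinN_def insert_absorb)
      then have "card (\<tau> - {a}) \<le> m"
        using * \<tau> a by blast
      then show ?thesis
        using a \<tau>(1) by simp
    qed
  next
    fix a \<tau> assume *: "\<forall>\<tau>\<in>M. card \<tau> \<le> Suc m" and "\<tau> \<in> residual M a"
    then have "finite \<tau>" "insert a \<tau> \<in> M" "a \<notin> \<tau>"
      by (auto simp: residual_def FinN_def)
    then show "card \<tau> \<le> m"
      using * by fastforce
  qed
  finally show ?case
    by simp
qed

text \<open>This is the classical bound on asymptotic dimension: the families vary with
  \<open>r\<close>, their number does not.\<close>

definition asdim_le :: "('p \<Rightarrow> 'p \<Rightarrow> real) \<Rightarrow> 'p set \<Rightarrow> nat \<Rightarrow> bool"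
  where "asdim_le d Y k \<longleftrightarrow> (\<forall>r>0. \<exists>\<U> :: nat \<Rightarrow> 'p set set.
    (\<forall>i\<le>k. \<U> i \<subseteq> Pow Y \<and> r_disjoint d r (\<U> i) \<and> uniformly_bounded d (\<U> i)) \<and>
    Y - \<Union> (\<Union>i\<le>k. \<U> i) = {})"

lemma asdim_leE:
  assumes "asdim_le d Y k" "r > 0"
  obtains \<U> where
    "\<And>i. i \<le> k \<Longrightarrow> \<U> i \<subseteq> Pow Y \<and> r_disjoint d r (\<U> i) \<and> uniformly_bounded d (\<U> i)"
    "Y \<subseteq> \<Union> (\<Union>i\<le>k. \<U> i)"
  using assms unfolding asdim_le_def Diff_eq_empty_iff by metis

text \<open>A finite ordinal has limit part 0, and only the value -1 lies below 0, so the uncovered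
  remainder must be empty.\<close>

lemma coasdim_le_finite_iff:
  "coasdim_le d Y ((osuc ^^ k) (0 :: 'k::infinite ordinal)) \<longleftrightarrow> asdim_le d Y k"
proof -
  have "\<not> \<beta> < 0" for \<beta> :: "'k ordinal"
    by (simp add: not_less)
  then show ?thesis
    unfolding asdim_le_def
    by (subst coasdim_le.simps) (simp add: limit_part_eq finite_part_eq limit_or_zero_0)
qed

lemma coasdim_le_omega_plus_iff:
  "coasdim_le d X ((osuc ^^ n) (omega :: 'k::infinite ordinal)) \<longleftrightarrow>
    (\<forall>r>0. \<exists>\<U>.
      (\<forall>i\<le>n. \<U> i \<subseteq> Pow X \<and> r_disjoint d r (\<U> i) \<and> uniformly_bounded d (\<U> i)) \<and>
      (\<exists>k. asdim_le d (X - \<Union> (\<Union>i\<le>n. \<U> i)) k))"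
proof -
  have *: "(Z = {} \<or> (\<exists>\<beta><omega :: 'k ordinal. coasdim_le d Z \<beta>)) \<longleftrightarrow> (\<exists>k. asdim_le d Z k)" for Z
    unfolding less_omega_iff using coasdim_le_finite_iff[of d Z, where ?'k = 'k]
    by (metis coasdim_le_empty)
  show ?thesis
    by (subst coasdim_le.simps)
      (simp only: limit_part_eq[OF limit_or_zero_omega] finite_part_eq[OF limit_or_zero_omega] * simp_thms ex_simps)
qed

lemma coasdim_le_omega_plusE:
  assumes "coasdim_le d X ((osuc ^^ n) (omega :: 'k::infinite ordinal))" "r > 0"
  obtains \<U> k where
    "\<forall>i\<le>n. \<U> i \<subseteq> Pow X \<and> r_disjoint d r (\<U> i) \<and> uniformly_bounded d (\<U> i)"
    "asdim_le d (X - \<Union> (\<Union>i\<le>n. \<U> i)) k"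
  using assms unfolding coasdim_le_omega_plus_iff by metis

section \<open>Pointwise forms of disjointness and boundedness\<close>

lemma r_disjointI:
  assumes "\<And>U V x y. U \<in> \<U> \<Longrightarrow> V \<in> \<U> \<Longrightarrow> U \<noteq> V \<Longrightarrow> x \<in> U \<Longrightarrow> y \<in> V \<Longrightarrow> r \<le> d x y"
  shows "r_disjoint d r \<U>"
  unfolding r_disjoint_def set_distance_def
  by (intro ballI impI INF_greatest ennreal_leI) (rule assms)

text \<open>Distinct members would be at distance at least \<open>r\<close>, yet \<open>x\<close>
  and \<open>y\<close> are closer. By \<open>0 \<le> d x y\<close> the comparison in
  \<open>ennreal\<close> carries over to the reals.\<close>

lemma r_disjointD:
  assumes "r_disjoint d r \<U>" "U \<in> \<U>" "V \<in> \<U>" "x \<in> U" "y \<in> V" "d x y < r" "0 \<le> d x y"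
  shows "U = V"
proof (rule ccontr)
  assume "U \<noteq> V"
  then have "ennreal r \<le> set_distance d U V"
    using assms by (auto simp: r_disjoint_def)
  also have "\<dots> \<le> ennreal (d x y)"
    unfolding set_distance_def using assms by (meson INF_lower2 INF_lower)
  finally show False
    using assms by (simp add: ennreal_le_iff)
qed

lemma r_disjoint_mono: "r_disjoint d r \<U> \<Longrightarrow> s \<le> r \<Longrightarrow> r_disjoint d s \<U>"
  unfolding r_disjoint_def by (meson ennreal_leI order_trans)

lemma uniformly_boundedI:
  assumes "\<And>U x y. U \<in> \<U> \<Longrightarrow> x \<in> U \<Longrightarrow> y \<in> U \<Longrightarrow> d x y \<le> R"
  shows "uniformly_bounded d \<U>"
proof -
  have "R_bounded d (max R 1) \<U>"
    unfolding R_bounded_def diam_def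
    by (intro SUP_least ennreal_leI) (use assms in \<open>fastforce simp: le_max_iff_disj\<close>)
  then show ?thesis
    unfolding uniformly_bounded_def by (intro exI[of _ "max R 1"]) simp
qed

lemma uniformly_boundedE:
  assumes "uniformly_bounded d \<U>"
  obtains R where "\<And>U x y. U \<in> \<U> \<Longrightarrow> x \<in> U \<Longrightarrow> y \<in> U \<Longrightarrow> d x y \<le> R"
proof -
  obtain R where R: "R > 0" "(SUP U\<in>\<U>. diam d U) \<le> ennreal R"
    using assms by (auto simp: uniformly_bounded_def R_bounded_def)
  have "d x y \<le> R" if "U \<in> \<U>" "x \<in> U" "y \<in> U" for U x y
  proof -
    have "ennreal (d x y) \<le> diam d U"
      unfolding diam_def using that by (meson SUP_upper2 SUP_upper)
    also have "\<dots> \<le> ennreal R"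
      using R(2) that(1) by (meson SUP_upper order_trans)
    finally show ?thesis
      using R(1) by (simp add: ennreal_le_iff)
  qed
  then show ?thesis
    by (rule that)
qed

section \<open>Comparison of the two dimensions\<close>

text \<open>If \<tau> had more than \<open>k\<close> elements, the \<open>k + 1\<close> families
  covering the remainder could be distributed over \<tau>. With the families on \<rho> they would
  form the cover that membership in \<open>A_family\<close> forbids.\<close>

lemma card_le_of_asdim_le:
  assumes mem: "\<tau> \<union> \<rho> \<in> A_family d X" and disj: "\<tau> \<inter> \<rho> = {}"
    and \<U>: "\<And>i. i \<in> \<rho> \<Longrightarrow>
      \<U> i \<subseteq> Pow X \<and> r_disjoint d (real i) (\<U> i) \<and> uniformly_bounded d (\<U> i)"
    and k: "asdim_le d (X - \<Union> (\<Union>i\<in>\<rho>. \<U> i)) k"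
  shows "card \<tau> \<le> k"
proof (rule ccontr)
  assume "\<not> card \<tau> \<le> k"
  have fin: "finite \<tau>"
    using mem by (auto simp: A_family_def FinN_def)
  \<comment> \<open>One scale that serves every index in \<tau>; the inserted 1 makes it
    positive.\<close>
  define R where "R = real (Max (insert 1 \<tau>))"
  have R: "real i \<le> R" if "i \<in> \<tau>" for i
    unfolding R_def using fin that by simp
  have "1 \<le> Max (insert 1 \<tau>)"
    using fin by (intro Max_ge) auto
  then have "0 < R"
    by (simp add: R_def)
  from asdim_leE[OF k this] obtain \<V> where
    \<V>: "\<And>i. i \<le> k \<Longrightarrow> \<V> i \<subseteq> Pow (X - \<Union> (\<Union>i\<in>\<rho>. \<U> i)) \<and> r_disjoint d R (\<V> i) \<and>
        uniformly_bounded d (\<V> i)"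
    and cov: "X - \<Union> (\<Union>i\<in>\<rho>. \<U> i) \<subseteq> \<Union> (\<Union>i\<le>k. \<V> i)"
    by blast
  obtain g where g: "bij_betw g \<tau> {0..<card \<tau>}"
    using ex_bij_betw_finite_nat[OF fin] by blast
  \<comment> \<open>Indices of \<tau> numbered beyond \<open>k\<close> receive the empty
    family.\<close>
  define \<W> where "\<W> i = (if i \<in> \<rho> then \<U> i else if g i \<le> k then \<V> (g i) else {})" for i
  have "\<W> i \<subseteq> Pow X \<and> uniformly_bounded d (\<W> i) \<and> r_disjoint d (real i) (\<W> i)"
    if "i \<in> \<tau> \<union> \<rho>" for i
  proof (cases "i \<in> \<rho>")
    case True
    then show ?thesis
      using \<U> by (simp add: \<W>_def)
  next
    case False
    then have "real i \<le> R"
      using that R by blast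
    then show ?thesis
      using False \<V>[of "g i"] by (auto simp: \<W>_def intro: r_disjoint_mono)
  qed
  moreover have "X \<subseteq> \<Union> (\<Union>i\<in>\<tau> \<union> \<rho>. \<W> i)"
  proof
    fix x assume "x \<in> X"
    show "x \<in> \<Union> (\<Union>i\<in>\<tau> \<union> \<rho>. \<W> i)"
    proof (cases "x \<in> \<Union> (\<Union>i\<in>\<rho>. \<U> i)")
      case True
      then obtain i where i: "i \<in> \<rho>" "x \<in> \<Union> (\<U> i)"
        by blast
      then have "x \<in> \<Union> (\<W> i)"
        by (simp add: \<W>_def)
      with i(1) show ?thesis
        by blast
    next
      case False
      with \<open>x \<in> X\<close> cov obtain j where j: "j \<le> k" "x \<in> \<Union> (\<V> j)"
        by blast
      then have "j \<in> g ` \<tau>"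
        using g \<open>\<not> card \<tau> \<le> k\<close> by (auto simp: bij_betw_def)
      then obtain i where i: "i \<in> \<tau>" "g i = j"
        by blast
      then have "x \<in> \<Union> (\<W> i)"
        using j disj by (auto simp: \<W>_def)
      with i(1) show ?thesis
        by blast
    qed
  qed
  ultimately show False
    using mem unfolding A_family_def by blast
qed

text \<open>At scale \<open>a\<close> one family leaves a remainder of finite asymptotic dimension.
  With that family at index \<open>a\<close>, the members of the residual have bounded size, so its
  ordinal is finite.\<close>

lemma Ord_le_omega_of_coasdim_le:
  assumes "coasdim_le d X (omega :: 'k::infinite ordinal)"
  shows "Ord_le (A_family d X) (omega :: 'k ordinal)"
  unfolding Ord_le_pos_iff[OF omega_pos]
proof
  fix a :: nat assume "a \<in> {1..}"
  then have pos: "real a > 0"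
    by simp
  have coas: "coasdim_le d X ((osuc ^^ 0) (omega :: 'k ordinal))"
    using assms by simp
  from coasdim_le_omega_plusE[OF coas pos] obtain \<U> :: "nat \<Rightarrow> 'a set set" and k where
    \<U>: "\<forall>i\<le>0.
      \<U> i \<subseteq> Pow X \<and> r_disjoint d (real a) (\<U> i) \<and> uniformly_bounded d (\<U> i)"
    and k: "asdim_le d (X - \<Union> (\<Union>i\<le>0. \<U> i)) k"
    by blast
  have "card \<tau> \<le> k" if "\<tau> \<in> residual (A_family d X) a" for \<tau>
    by (rule card_le_of_asdim_le[where \<rho> = "{a}" and \<U> = "\<lambda>_. \<U> 0" and d = d and X = X])
      (use that \<U> k in \<open>auto simp: residual_def\<close>)
  then have "Ord_le (residual (A_family d X) a) ((osuc ^^ k) (0 :: 'k ordinal))"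
    by (simp add: Ord_le_finite_iff[OF residual_subset_FinN])
  then show "\<exists>\<beta><omega :: 'k ordinal. Ord_le (residual (A_family d X) a) \<beta>"
    using less_omega_iff by blast
qed

text \<open>Here there are two families at scale \<open>max a b\<close>. One serves the index
  \<open>a\<close>, the other the index \<open>b\<close>, which bounds the members of the double
  residual.\<close>

lemma Ord_le_osuc_omega_of_coasdim_le:
  assumes "coasdim_le d X (osuc (omega :: 'k::infinite ordinal))"
  shows "Ord_le (A_family d X) (osuc (omega :: 'k ordinal))"
  unfolding Ord_le_pos_iff[OF osuc_pos]
proof
  fix a :: nat assume a: "a \<in> {1..}"
  have "Ord_le (residual (A_family d X) a) (omega :: 'k ordinal)"
    unfolding Ord_le_pos_iff[OF omega_pos]
  proof
    fix b :: nat assume "b \<in> {1..}"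
    have pos: "real (max a b) > 0"
      using a by simp
    have coas: "coasdim_le d X ((osuc ^^ 1) (omega :: 'k ordinal))"
      using assms by simp
    from coasdim_le_omega_plusE[OF coas pos] obtain \<U> :: "nat \<Rightarrow> 'a set set" and k where
      \<U>: "\<forall>i\<le>1.
        \<U> i \<subseteq> Pow X \<and> r_disjoint d (real (max a b)) (\<U> i) \<and> uniformly_bounded d (\<U> i)"
      and k: "asdim_le d (X - \<Union> (\<Union>i\<le>1. \<U> i)) k"
      by blast
    have "card \<tau> \<le> k" if \<tau>: "\<tau> \<in> residual (residual (A_family d X) a) b" for \<tau>
    proof (rule card_le_of_asdim_le[where \<rho> = "{a, b}" and d = d and X = X
          and \<U> = "\<lambda>i. if i = a then \<U> 0 else \<U> 1"])
      show "\<tau> \<union> {a, b} \<in> A_family d X" "\<tau> \<inter> {a, b} = {}"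
        using \<tau> by (auto simp: residual_def insert_commute)
      have "b \<noteq> a"
        using \<tau> by (auto simp: residual_def)
      moreover have "{..1} = {0, 1::nat}"
        by auto
      ultimately have "\<Union> (\<Union>i\<in>{a, b}. if i = a then \<U> 0 else \<U> 1) = \<Union> (\<Union>i\<le>1. \<U> i)"
        by (simp add: Un_commute)
      with k show "asdim_le d (X - \<Union> (\<Union>i\<in>{a, b}. if i = a then \<U> 0 else \<U> 1)) k"
        by simp
      fix i assume "i \<in> {a, b}"
      then have le: "real i \<le> real (max a b)"
        by auto
      have "\<exists>j\<le>1. (if i = a then \<U> 0 else \<U> 1) = \<U> j"
        by auto
      then obtain j where j: "j \<le> 1" "(if i = a then \<U> 0 else \<U> 1) = \<U> j"
        by blast
      have \<U>j: "\<U> j \<subseteq> Pow X" "r_disjoint d (real (max a b)) (\<U> j)"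
        "uniformly_bounded d (\<U> j)"
        using \<U>[rule_format, OF j(1)] by auto
      show "(if i = a then \<U> 0 else \<U> 1) \<subseteq> Pow X \<and>
          r_disjoint d (real i) (if i = a then \<U> 0 else \<U> 1) \<and>
          uniformly_bounded d (if i = a then \<U> 0 else \<U> 1)"
        unfolding j(2) by (intro conjI \<U>j r_disjoint_mono[OF \<U>j(2) le])
    qed
    then have "Ord_le (residual (residual (A_family d X) a) b) ((osuc ^^ k) (0 :: 'k ordinal))"
      by (simp add: Ord_le_finite_iff[OF residual_subset_FinN])
    then show "\<exists>\<beta><omega :: 'k ordinal. Ord_le (residual (residual (A_family d X) a) b) \<beta>"
      using less_omega_iff by blast
  qed
  then show "\<exists>\<beta><osuc (omega :: 'k ordinal). Ord_le (residual (A_family d X) a) \<beta>"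
    using less_osuc by blast
qed


section \<open>A discrete Lebesgue covering theorem\<close>

text \<open>
  For each colour \<open>i\<close>, label by \<open>0\<close> the points next to a class of colour \<open>i\<close> that starts at the
  face \<open>x i = 0\<close>, and by \<open>1\<close> all others. Kuhn's lemma yields a unit cube in which every one of the
  \<open>n\<close> labels takes both values, but the label of the colour of the lowest corner is constant there.
\<close>

lemma lebesgue_grid:
  fixes n D :: nat and c :: "(nat \<Rightarrow> nat) \<Rightarrow> nat" and f :: "(nat \<Rightarrow> nat) \<Rightarrow> 'a"
  defines "grid \<equiv> {x. \<forall>i<n. x i \<le> D + 3}"
  assumes col: "\<And>x. x \<in> grid \<Longrightarrow> c x < n"
    and near: "\<And>x y. x \<in> grid \<Longrightarrow> y \<in> grid \<Longrightarrow> c x = c y \<Longrightarrow>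
      (\<And>j. j < n \<Longrightarrow> x j \<le> y j + 2 \<and> y j \<le> x j + 2) \<Longrightarrow> f x = f y"
    and bounded: "\<And>x y j. x \<in> grid \<Longrightarrow> y \<in> grid \<Longrightarrow> c x = c y \<Longrightarrow> f x = f y \<Longrightarrow> j < n \<Longrightarrow>
      x j \<le> y j + D"
  shows False
proof -
  define reach where "reach x i \<longleftrightarrow> x i = 0 \<or> (\<exists>z\<in>grid. \<exists>w\<in>grid. c z = i \<and> c w = i \<and> f z = f w \<and>
    (\<forall>j<n. x j \<le> z j + 1 \<and> z j \<le> x j + 1) \<and> w i \<le> 1)" for x i
  define label where "label x i = (if reach x i then 0 else 1 :: nat)" for x i
  \<comment> \<open>A class that starts at height at most 1 ends at height at most
    \<open>D + 1\<close>, and its neighbours at most at \<open>D + 2\<close>. Hence the side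
    \<open>D + 3\<close> of the grid.\<close>
  have top: "\<not> reach x i" if "i < n" "x i = D + 3" for x i
  proof
    assume "reach x i"
    with that obtain z w where zw: "z \<in> grid" "w \<in> grid" "c z = i" "c w = i" "f z = f w"
      "\<forall>j<n. x j \<le> z j + 1" "w i \<le> 1"
      by (auto simp: reach_def)
    then have "z i \<le> w i + D"
      using bounded[of z w i] \<open>i < n\<close> by simp
    with zw that show False
      by fastforce
  qed
  have "0 < D + 3"
    by simp
  then obtain q where q: "\<forall>i<n. q i < D + 3"
    and ex: "\<forall>i<n. \<exists>r s. (\<forall>j<n. q j \<le> r j \<and> r j \<le> q j + 1) \<and>
      (\<forall>j<n. q j \<le> s j \<and> s j \<le> q j + 1) \<and> label r i \<noteq> label s i"
    by (rule kuhn_lemma[of "D + 3" n label])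
      (auto simp: label_def top, auto simp: reach_def)
  have qg: "q \<in> grid"
    using q by (auto simp: grid_def intro: less_imp_le)
  define i where "i = c q"
  have i: "i < n"
    unfolding i_def by (rule col[OF qg])
  with ex obtain r s where rs: "\<forall>j<n. q j \<le> r j \<and> r j \<le> q j + 1"
    "\<forall>j<n. q j \<le> s j \<and> s j \<le> q j + 1" "reach r i" "\<not> reach s i"
    unfolding label_def by (metis (no_types, lifting))
  \<comment> \<open>A \<open>w\<close> in the class of \<open>q\<close> with
    \<open>w i \<le> 1\<close> would yield \<open>reach s i\<close> by way of \<open>q\<close>, a
    neighbour of \<open>s\<close>.\<close>
  have no: "1 < w i" if "w \<in> grid" "c w = i" "f w = f q" for w
    using rs(2,4) that qg unfolding reach_def i_def by (metis le_SucI add.commute not_le plus_1_eq_Suc)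
  have "r i \<noteq> 0"
    using no[OF qg] rs(1) i by (force simp: i_def)
  with rs(3) obtain z w where zw: "z \<in> grid" "w \<in> grid" "c z = i" "c w = i" "f z = f w"
    "\<forall>j<n. r j \<le> z j + 1 \<and> z j \<le> r j + 1" "w i \<le> 1"
    unfolding reach_def by blast
  \<comment> \<open>From \<open>z\<close> to \<open>r\<close> and from \<open>r\<close> to
    \<open>q\<close> is one step each, whence the 2 in \<open>near\<close>. Then \<open>w\<close>
    lies in the class of \<open>q\<close> and contradicts \<open>no\<close>.\<close>
  have "f z = f q"
  proof (rule near[OF zw(1) qg])
    show "c z = c q"
      using zw(3) by (simp add: i_def)
    fix j assume "j < n"
    then show "z j \<le> q j + 2 \<and> q j \<le> z j + 2"
      using zw(6) rs(1) by fastforce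
  qed
  then show False
    using no[OF zw(2,4)] zw by simp
qed


section \<open>The metric of the space\<close>

lemma d_omega1_same_length_le:
  assumes "length a = length b" "0 \<le> c" "\<And>i. i < length a \<Longrightarrow> \<bar>a ! i - b ! i\<bar> \<le> c"
  shows "d_omega1 a b \<le> c"
proof -
  have "d_max (pad a) (pad b) \<le> c"
    unfolding d_max_def by (rule cSUP_least) (use assms in \<open>auto simp: pad_def\<close>)
  then show ?thesis
    using assms by (simp add: d_omega1_def level_gap_def)
qed

lemma coordinate_le_d_omega1:
  assumes "length a = length b" "i < length a"
  shows "\<bar>a ! i - b ! i\<bar> \<le> d_omega1 a b"
  using d_max_pad_upper[of a i b] assms by (simp add: d_omega1_def pad_def le_max_iff_disj)

text \<open>The smaller length is itself a summand of the gap. So pieces of large index are far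
  apart.\<close>

lemma d_omega1_different_length:
  assumes "length a \<noteq> length b"
  shows "real (min (length a) (length b)) \<le> d_omega1 a b"
proof -
  have "min (length a) (length b) \<le> level_gap (length a) (length b)"
    unfolding level_gap_def by (rule member_le_sum) (use assms in auto)
  then show ?thesis
    by (simp add: d_omega1_def le_max_iff_disj)
qed

lemma d_omega1_nonneg: "0 \<le> d_omega1 x y"
  and d_omega1_commute: "d_omega1 x y = d_omega1 y x"
  using Metric_space_X_omega1 by (simp_all add: Metric_space_def)

lemma d_omega1_triangle:
  "x \<in> X_omega1 \<Longrightarrow> y \<in> X_omega1 \<Longrightarrow> z \<in> X_omega1 \<Longrightarrow>
    d_omega1 x z \<le> d_omega1 x y + d_omega1 y z"
  using Metric_space_X_omega1 by (simp add: Metric_space_def)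


section \<open>The upper bound\<close>

text \<open>With families given by a key, disjointness is a condition on points with different keys
  and boundedness one on points with equal keys.\<close>

definition fibres :: "('p \<Rightarrow> 'q) \<Rightarrow> 'p set \<Rightarrow> 'p set set"
  where "fibres key S = (\<lambda>y. {x \<in> S. key x = key y}) ` S"

lemma fibres_subset_Pow: "S \<subseteq> X \<Longrightarrow> fibres key S \<subseteq> Pow X"
  by (auto simp: fibres_def)

lemma Union_fibres [simp]: "\<Union> (fibres key S) = S"
  by (auto simp: fibres_def)

lemma Union_UN_fibres: "\<Union> (\<Union>i\<in>I. fibres key (T i)) = (\<Union>i\<in>I. T i)"
proof -
  have "\<Union> (\<Union>i\<in>I. fibres key (T i)) = (\<Union>i\<in>I. \<Union> (fibres key (T i)))"
    by blast
  then show ?thesis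
    by simp
qed

lemma r_disjoint_fibres:
  assumes "\<And>x y. x \<in> S \<Longrightarrow> y \<in> S \<Longrightarrow> key x \<noteq> key y \<Longrightarrow> r \<le> d x y"
  shows "r_disjoint d r (fibres key S)"
  by (rule r_disjointI, rule assms) (auto simp: fibres_def)

lemma uniformly_bounded_fibres:
  assumes "\<And>x y. x \<in> S \<Longrightarrow> y \<in> S \<Longrightarrow> key x = key y \<Longrightarrow> d x y \<le> R"
  shows "uniformly_bounded d (fibres key S)"
  by (rule uniformly_boundedI[of _ _ R]) (use assms in \<open>auto simp: fibres_def\<close>)

section \<open>Rounding coordinates to multiples of a step\<close>

definition cells :: "real \<Rightarrow> real list \<Rightarrow> int list"
  where "cells L x = map (\<lambda>t. round (t / L)) x"

lemma length_cells [simp]: "length (cells L x) = length x"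
  by (simp add: cells_def)

lemma nth_cells [simp]: "i < length x \<Longrightarrow> cells L x ! i = round (x ! i / L)"
  by (simp add: cells_def)

lemma round_dist:
  fixes s t L :: real
  assumes "L > 0"
  shows "\<bar>\<bar>s - t\<bar> / L - \<bar>real_of_int (round (s / L) - round (t / L))\<bar>\<bar> \<le> 1"
proof -
  have "\<bar>s - t\<bar> / L = \<bar>s / L - t / L\<bar>"
    using abs_div_pos[OF assms, of "s - t"] by (simp only: diff_divide_distrib)
  moreover have "\<bar>real_of_int (round (s / L)) - s / L\<bar> \<le> 1/2"
    "\<bar>real_of_int (round (t / L)) - t / L\<bar> \<le> 1/2"
    by (rule of_int_round_abs_le)+
  ultimately show ?thesis
    by linarith
qed

lemma cells_eq_imp_le:
  assumes "L > 0" "cells L x = cells L y"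
  shows "d_omega1 x y \<le> L"
proof -
  have len: "length x = length y"
    using assms(2) by (metis length_cells)
  show ?thesis
  proof (rule d_omega1_same_length_le[OF len])
    fix i assume "i < length x"
    then have "round (x ! i / L) = round (y ! i / L)"
      using assms(2) len by (metis nth_cells)
    then show "\<bar>x ! i - y ! i\<bar> \<le> L"
      using round_dist[OF assms(1), of "x ! i" "y ! i"] assms(1) by (simp add: divide_simps)
  qed (use assms in simp)
qed

text \<open>Distinct integers of equal parity differ by at least 2, and the two roundings account
  for at most 1 of it.\<close>

lemma cells_same_parity_far:
  assumes "L > 0" "length x = length y" "i < length x" "cells L x ! i \<noteq> cells L y ! i"
    "even (cells L x ! i) \<longleftrightarrow> even (cells L y ! i)"
  shows "L \<le> d_omega1 x y"
proof -
  define k where "k = round (x ! i / L) - round (y ! i / L)"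
  have "even k" "k \<noteq> 0"
    using assms by (auto simp: k_def)
  then have "2 \<le> \<bar>k\<bar>"
    by (auto elim!: evenE)
  then have "2 \<le> \<bar>real_of_int k\<bar>"
    by linarith
  then have "1 \<le> \<bar>x ! i - y ! i\<bar> / L"
    using round_dist[OF assms(1), of "x ! i" "y ! i"] unfolding k_def by linarith
  then have "L \<le> \<bar>x ! i - y ! i\<bar>"
    using assms(1) by (simp add: divide_simps)
  then show ?thesis
    using coordinate_le_d_omega1[OF assms(2,3)] by linarith
qed

text \<open>Multiples of \<open>m\<close> are exact even multiples of \<open>L\<close>. So an odd
  cell number can occur only at the free coordinate of \<open>x\<close>.\<close>

lemma X_piece_eq_mult:
  assumes x: "x \<in> X_piece m" and m: "real m = 2 * real q * L" and "L > 0"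
    and j: "j < m" "odd (cells L x ! j)" and i: "i < m" "i \<noteq> j"
  obtains e :: int where "even e" "x ! i / L = of_int e"
proof -
  obtain j0 where len: "length x = m"
    and j0: "\<And>i. i < m \<Longrightarrow> i \<noteq> j0 \<Longrightarrow> \<exists>k::int. x ! i = real m * of_int k"
    using x by (auto simp: X_piece_def)
  have *: "\<exists>e::int. even e \<and> x ! i / L = of_int e" if "i < m" "i \<noteq> j0" for i
  proof -
    from j0[OF that] obtain k :: int where "x ! i = real m * of_int k"
      by blast
    then have "x ! i / L = of_int (2 * int q * k)"
      using m \<open>L > 0\<close> by simp
    then show ?thesis
      by (intro exI[of _ "2 * int q * k"]) simp
  qed
  have "j = j0"
  proof (rule ccontr)
    assume "j \<noteq> j0"
    with * j(1) obtain e :: int where "even e" "x ! j / L = of_int e"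
      by blast
    then show False
      using j len by simp
  qed
  with * i that show ?thesis
    by blast
qed

text \<open>As \<open>y\<close> is odd at \<open>j\<close>, its coordinate \<open>i\<close> is
  exactly an even multiple of \<open>L\<close>, while \<open>x ! i\<close> rounds to an odd one.
  Only one rounding error enters, which leaves \<open>L / 2\<close>.\<close>

lemma X_piece_different_parity_far:
  assumes x: "x \<in> X_piece m" and y: "y \<in> X_piece m" and m: "real m = 2 * real q * L" and "L > 0"
    and i: "i < m" "odd (cells L x ! i)" "even (cells L y ! i)"
    and j: "j < m" "odd (cells L y ! j)"
  shows "L / 2 \<le> d_omega1 x y"
proof -
  have len: "length x = m" "length y = m"
    using x y by (auto simp: X_piece_def)
  have "i \<noteq> j"
    using i j by auto
  then obtain e :: int where e: "even e" "y ! i / L = of_int e"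
    using X_piece_eq_mult[OF y m \<open>L > 0\<close> j i(1)] by blast
  have "round (x ! i / L) \<noteq> e"
    using i e(1) len by auto
  then have "1 \<le> \<bar>real_of_int (round (x ! i / L)) - of_int e\<bar>"
    by linarith
  moreover have "\<bar>real_of_int (round (x ! i / L)) - x ! i / L\<bar> \<le> 1/2"
    by (rule of_int_round_abs_le)
  ultimately have "1/2 \<le> \<bar>x ! i / L - y ! i / L\<bar>"
    unfolding e(2) by linarith
  also have "\<dots> = \<bar>x ! i - y ! i\<bar> / L"
    using abs_div_pos[OF \<open>L > 0\<close>, of "x ! i - y ! i"] by (simp only: diff_divide_distrib)
  finally have "L / 2 \<le> \<bar>x ! i - y ! i\<bar>"
    using \<open>L > 0\<close> by (simp add: divide_simps)
  then show ?thesis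
    using coordinate_le_d_omega1[of x y i] len i(1) by simp
qed

lemma X_piece_cells_far:
  assumes x: "x \<in> X_piece m" and y: "y \<in> X_piece m" and m: "real m = 2 * real q * L" and L: "L > 0"
    and ne: "cells L x \<noteq> cells L y"
    and par: "(\<forall>e\<in>set (cells L x). even e) \<longleftrightarrow> (\<forall>e\<in>set (cells L y). even e)"
  shows "L / 2 \<le> d_omega1 x y"
proof -
  have len: "length x = m" "length y = m"
    using x y by (auto simp: X_piece_def)
  obtain i where i: "i < m" "cells L x ! i \<noteq> cells L y ! i"
    using ne len by (metis length_cells nth_equalityI)
  show ?thesis
  proof (cases "even (cells L x ! i) \<longleftrightarrow> even (cells L y ! i)")
    case True
    then have "L \<le> d_omega1 x y"
      using cells_same_parity_far[OF L, of x y i] i len by simp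
    then show ?thesis
      using L by linarith
  next
    case False
    \<comment> \<open>One of the two points is odd at \<open>i\<close>; by \<open>par\<close> the
      other one is odd somewhere.\<close>
    then have "\<not> (\<forall>e\<in>set (cells L x). even e)" "\<not> (\<forall>e\<in>set (cells L y). even e)"
      using par i(1) len by (metis length_cells nth_mem)+
    then obtain j j' where j: "j < m" "odd (cells L x ! j)" "j' < m" "odd (cells L y ! j')"
      using len by (metis in_set_conv_nth length_cells)
    show ?thesis
    proof (cases "even (cells L x ! i)")
      case True
      with False show ?thesis
        using X_piece_different_parity_far[OF y x m L i(1) _ _ j(1,2)]
        by (simp add: d_omega1_commute)
    next
      case odd: False
      with False show ?thesis
        using X_piece_different_parity_far[OF x y m L i(1) _ _ j(3,4)] by simp
    qed
  qed
qed

text \<open>The lower bound on \<open>L\<close> makes the gap \<open>L / 2\<close> at least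
  \<open>r\<close>; the upper one bounds the cells independently of \<open>m\<close>.\<close>

lemma ex_even_subdivision:
  fixes r :: real and m :: nat
  assumes "r > 0" "4 * r \<le> real m"
  obtains q L where "real m = 2 * real q * L" "2 * r \<le> L" "L \<le> 4 * r"
proof -
  \<comment> \<open>Rounding down gives \<open>2 * r \<le> L\<close>;
    \<open>q + 1 \<le> 2 * q\<close> gives \<open>L \<le> 4 * r\<close>.\<close>
  define q where "q = nat \<lfloor>real m / (4 * r)\<rfloor>"
  have "1 \<le> real m / (4 * r)"
    using assms by simp
  then have q1: "1 \<le> q" "real q \<le> real m / (4 * r)" "real m / (4 * r) < real q + 1"
    unfolding q_def by linarith+
  define L where "L = real m / (2 * real q)"
  show ?thesis
  proof (rule that)
    show "real m = 2 * real q * L"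
      using q1 by (simp add: L_def)
    have "real q * (4 * r) \<le> real m"
      using q1(2) assms(1) by (simp only: pos_le_divide_eq mult_pos_pos zero_less_numeral)
    then have "2 * r * (2 * real q) \<le> real m"
      by (simp add: mult.commute mult.left_commute)
    then show "2 * r \<le> L"
      unfolding L_def using q1(1) by (subst pos_le_divide_eq) simp_all
    have "real m / (4 * r) < 2 * real q"
      using q1 by linarith
    then have "real m < 2 * real q * (4 * r)"
      using assms(1) by (simp only: pos_divide_less_eq mult_pos_pos zero_less_numeral)
    then have "real m \<le> 4 * r * (2 * real q)"
      by (simp add: mult.commute mult.left_commute)
    then show "L \<le> 4 * r"
      unfolding L_def using q1(1) by (subst pos_divide_le_eq) simp_all
  qed
qed

section \<open>The remaining pieces and the resulting cover\<close>

text \<open>The number of parity vectors of length below \<open>N\<close> does not depend on the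
  scale. A common parity vector forces equal lengths, so distinct cells are separated by
  \<open>cells_same_parity_far\<close>.\<close>

lemma asdim_le_bounded_length:
  assumes Y: "Y \<subseteq> {x. length x < N}"
  shows "\<exists>k. asdim_le d_omega1 Y k"
proof -
  have eq: "{p :: bool list. length p < N} \<subseteq> {p. set p \<subseteq> UNIV \<and> length p \<le> N}"
    by auto
  have "finite {p :: bool list. length p < N}"
    by (rule finite_subset[OF eq], rule finite_lists_length_le) simp
  \<comment> \<open>The vectors have indices below \<open>k\<close>; the family at the extra index
    \<open>k\<close> obeys the same estimates, whatever \<open>h k\<close> is.\<close>
  then obtain k and h :: "nat \<Rightarrow> bool list" where h: "{p. length p < N} = h ` {i. i < k}"
    unfolding finite_conv_nat_seg_image by blast
  have "asdim_le d_omega1 Y k"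
    unfolding asdim_le_def
  proof (intro allI impI)
    fix r :: real assume r: "r > 0"
    define T where "T i = {x \<in> Y. map odd (cells r x) = h i}" for i
    have "r_disjoint d_omega1 r (fibres (cells r) (T i))" for i
    proof (rule r_disjoint_fibres)
      fix x y assume xy: "x \<in> T i" "y \<in> T i" "cells r x \<noteq> cells r y"
      then have par: "map odd (cells r x) = map odd (cells r y)"
        by (simp add: T_def)
      then have len: "length x = length y"
        by (metis length_cells length_map)
      with xy(3) obtain j where j: "j < length x" "cells r x ! j \<noteq> cells r y ! j"
        by (metis length_cells nth_equalityI)
      have "map odd (cells r x) ! j \<longleftrightarrow> map odd (cells r y) ! j"
        using par by simp
      then have "odd (cells r x ! j) \<longleftrightarrow> odd (cells r y ! j)"
        using j(1) len by (simp del: nth_cells)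
      then show "r \<le> d_omega1 x y"
        by (intro cells_same_parity_far[OF r len j]) simp
    qed
    moreover have "uniformly_bounded d_omega1 (fibres (cells r) (T i))" for i
      by (rule uniformly_bounded_fibres) (rule cells_eq_imp_le[OF r])
    moreover have "fibres (cells r) (T i) \<subseteq> Pow Y" for i
      by (rule fibres_subset_Pow) (auto simp: T_def)
    moreover have "x \<in> (\<Union>i\<le>k. T i)" if "x \<in> Y" for x
    proof -
      have "map odd (cells r x) \<in> h ` {i. i < k}"
        using that Y unfolding h[symmetric] by auto
      then obtain i where "i < k" "map odd (cells r x) = h i"
        by blast
      then show ?thesis
        using that by (intro UN_I[of i]) (auto simp: T_def)
    qed
    then have "Y - \<Union> (\<Union>i\<le>k. fibres (cells r) (T i)) = {}"
      unfolding Union_UN_fibres by blast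
    ultimately show "\<exists>\<U>. (\<forall>i\<le>k. \<U> i \<subseteq> Pow Y \<and> r_disjoint d_omega1 r (\<U> i) \<and>
        uniformly_bounded d_omega1 (\<U> i)) \<and> Y - \<Union> (\<Union>i\<le>k. \<U> i) = {}"
      by (intro exI[of _ "\<lambda>i. fibres (cells r) (T i)"]) blast
  qed
  then show ?thesis ..
qed

lemma X_omega1_piece: "x \<in> X_omega1 \<Longrightarrow> x \<in> X_piece (length x)"
  by (auto simp: X_omega1_def X_piece_def)

lemma coasdim_le_osuc_omega: "coasdim_le d_omega1 X_omega1 (osuc omega :: 'k::infinite ordinal)"
proof -
  have "coasdim_le d_omega1 X_omega1 ((osuc ^^ 1) (omega :: 'k ordinal))"
    unfolding coasdim_le_omega_plus_iff
  proof (intro allI impI)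
    fix r :: real assume r: "r > 0"
    \<comment> \<open>From index \<open>N\<close> on, a suitable step exists and different pieces
      are at least \<open>r\<close> apart.\<close>
    obtain N :: nat where N: "4 * r \<le> real N"
      using real_arch_simple by blast
    have "\<exists>q L. real m = 2 * real q * L \<and> 2 * r \<le> L \<and> L \<le> 4 * r" if "N \<le> m" for m
    proof -
      have "4 * r \<le> real m"
        using that N by linarith
      then show ?thesis
        by (rule ex_even_subdivision[OF r]) blast
    qed
    then obtain q L where qL: "\<And>m. N \<le> m \<Longrightarrow>
        real m = 2 * real (q m) * L m \<and> 2 * r \<le> L m \<and> L m \<le> 4 * r"
      by metis
    define key where "key x = cells (L (length x)) x" for x
    define S where "S i = {x \<in> X_omega1. N \<le> length x \<and> ((\<forall>e\<in>set (key x). even e) \<longleftrightarrow> i = 0)}"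
      for i :: nat
    have disj: "r_disjoint d_omega1 r (fibres key (S i))" for i
    proof (rule r_disjoint_fibres)
      fix x y assume xy: "x \<in> S i" "y \<in> S i" "key x \<noteq> key y"
      show "r \<le> d_omega1 x y"
      proof (cases "length x = length y")
        case True
        define m where "m = length x"
        have m: "N \<le> m" "x \<in> X_piece m" "y \<in> X_piece m"
          using xy True by (auto simp: S_def m_def dest: X_omega1_piece)
        have "L m / 2 \<le> d_omega1 x y"
          by (rule X_piece_cells_far[OF m(2,3), of "q m"])
            (use qL[OF m(1)] r xy True in \<open>auto simp: m_def key_def S_def\<close>)
        then show ?thesis
          using qL[OF m(1)] by linarith
      next
        case False
        have "N \<le> min (length x) (length y)"
          using xy by (simp add: S_def)
        then show ?thesis
          using d_omega1_different_length[OF False] N r by linarith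
      qed
    qed
    have bdd: "uniformly_bounded d_omega1 (fibres key (S i))" for i
    proof (rule uniformly_bounded_fibres)
      fix x y assume xy: "x \<in> S i" "y \<in> S i" "key x = key y"
      then have len: "length x = length y"
        unfolding key_def by (metis length_cells)
      have "N \<le> length x"
        using xy by (simp add: S_def)
      note L = qL[OF this]
      have "d_omega1 x y \<le> L (length x)"
        by (rule cells_eq_imp_le) (use xy L r len in \<open>auto simp: key_def\<close>)
      then show "d_omega1 x y \<le> 4 * r"
        using L by linarith
    qed
    have sub: "fibres key (S i) \<subseteq> Pow X_omega1" for i
      by (rule fibres_subset_Pow) (auto simp: S_def)
    have rest: "\<exists>k. asdim_le d_omega1 (X_omega1 - \<Union> (\<Union>i\<le>1. fibres key (S i))) k"
    proof (intro asdim_le_bounded_length[of _ N] subsetI)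
      fix x assume x: "x \<in> X_omega1 - \<Union> (\<Union>i\<le>1. fibres key (S i))"
      then have "x \<notin> S 0" "x \<notin> S 1"
        unfolding Union_UN_fibres by auto
      then show "x \<in> {x. length x < N}"
        using x by (auto simp: S_def)
    qed
    show "\<exists>\<U> :: nat \<Rightarrow> real list set set. (\<forall>i\<le>1. \<U> i \<subseteq> Pow X_omega1 \<and> r_disjoint d_omega1 r (\<U> i) \<and>
        uniformly_bounded d_omega1 (\<U> i)) \<and>
        (\<exists>k. asdim_le d_omega1 (X_omega1 - \<Union> (\<Union>i\<le>1. \<U> i)) k)"
      by (intro exI[of _ "\<lambda>i. fibres key (S i)"] conjI allI impI sub disj bdd rest)
  qed
  then show ?thesis
    by simp
qed


section \<open>The lower bound\<close>

definition grid_point :: "nat \<Rightarrow> (nat \<Rightarrow> nat) \<Rightarrow> real list"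
  where "grid_point n u = map (\<lambda>i. real (u i)) [0..<n]"

lemma grid_point_in_X_piece:
  assumes "j < n" "\<And>i. i < n \<Longrightarrow> i \<noteq> j \<Longrightarrow> n dvd u i"
  shows "grid_point n u \<in> X_piece n"
proof -
  have "\<exists>k::int. real (u i) = real n * of_int k" if i: "i < n" "i \<noteq> j" for i
  proof -
    obtain k where "u i = n * k"
      using assms(2)[OF i] by blast
    then show ?thesis
      by (intro exI[of _ "int k"]) simp
  qed
  then show ?thesis
    using assms(1) by (auto simp: X_piece_def grid_point_def)
qed

lemma d_omega1_grid_point_le:
  assumes "\<And>i. i < n \<Longrightarrow> u i \<le> v i + k \<and> v i \<le> u i + k"
  shows "d_omega1 (grid_point n u) (grid_point n v) \<le> real k"
proof (rule d_omega1_same_length_le)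
  fix i assume "i < length (grid_point n u)"
  then have i: "i < n"
    by (simp add: grid_point_def)
  have "real (u i) \<le> real (v i + k)" "real (v i) \<le> real (u i + k)"
    unfolding of_nat_le_iff using assms[OF i] by simp_all
  then show "\<bar>grid_point n u ! i - grid_point n v ! i\<bar> \<le> real k"
    using i by (simp add: grid_point_def abs_le_iff)
qed (simp_all add: grid_point_def)

lemma coordinate_le_d_omega1_grid_point:
  "i < n \<Longrightarrow> real (u i) \<le> real (v i) + d_omega1 (grid_point n u) (grid_point n v)"
  using coordinate_le_d_omega1[of "grid_point n u" "grid_point n v" i]
  by (simp add: grid_point_def)

lemma interval_propagate:
  fixes s t :: nat
  assumes step: "\<And>k. lo \<le> k \<Longrightarrow> k < hi \<Longrightarrow> Q k \<longleftrightarrow> Q (Suc k)"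
    and "s \<in> {lo..hi}" "t \<in> {lo..hi}" "Q s"
  shows "Q t"
proof -
  have "k \<le> hi \<longrightarrow> (Q k \<longleftrightarrow> Q lo)" if "lo \<le> k" for k
    using that
  proof (induction k rule: dec_induct)
    case (step k)
    then show ?case
      using assms(1)[of k] by simp
  qed simp
  from this[of s] this[of t] show ?thesis
    using assms(2-4) by simp
qed

text \<open>
  If the grid around the vertex \<open>n x\<close> is covered by a \<open>2\<close>-disjoint family, one member contains all
  of its vertices: walk along the edges in unit steps, changing one coordinate at a time.
\<close>

lemma r_disjoint_neighbourhood:
  assumes disj: "r_disjoint d_omega1 2 \<U>"
    and cov: "\<And>z. z \<in> X_piece n \<Longrightarrow> d_omega1 (grid_point n (\<lambda>i. n * x i)) z \<le> 2 * real n \<Longrightarrow>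
      z \<in> \<Union> \<U>"
    and near: "\<And>i. i < n \<Longrightarrow> x i \<le> y i + 2 \<and> y i \<le> x i + 2"
    and U: "U \<in> \<U>" "grid_point n (\<lambda>i. n * x i) \<in> U"
  shows "grid_point n (\<lambda>i. n * y i) \<in> U"
proof -
  define w where "w k i = n * (if i < k then y i else x i)" for k i
  have "grid_point n (w k) \<in> U" if "k \<le> n" for k
    using that
  proof (induction k)
    case 0
    then show ?case
      using U(2) by (simp add: w_def)
  next
    case (Suc k)
    \<comment> \<open>Only coordinate \<open>k\<close> leaves the multiples of \<open>n\<close>, so
      the points run along an edge of \<open>X_piece n\<close>.\<close>
    define P where "P t = grid_point n ((w k)(k := t))" for t
    define lo hi where "lo = n * min (x k) (y k)" and "hi = n * max (x k) (y k)"
    have "max (x k) (y k) \<le> x k + 2" "x k \<le> min (x k) (y k) + 2"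
      using near[of k] Suc.prems by auto
    then have "hi \<le> n * (x k + 2)" "n * x k \<le> n * (min (x k) (y k) + 2)"
      unfolding hi_def by (simp_all only: mult_le_mono2)
    then have lohi: "hi \<le> n * x k + 2 * n" "n * x k \<le> lo + 2 * n"
      by (simp_all add: lo_def algebra_simps)
    have ex: "\<exists>V\<in>\<U>. P t \<in> V" if t: "lo \<le> t" "t \<le> hi" for t
    proof -
      have "P t \<in> X_piece n"
        unfolding P_def using Suc.prems by (intro grid_point_in_X_piece[of k]) (auto simp: w_def)
      \<comment> \<open>Coordinates of \<open>x\<close> and \<open>y\<close> differ by at most 2;
        scaled by \<open>n\<close>, the path stays within the reach of \<open>cov\<close>.\<close>
      moreover have "d_omega1 (grid_point n (\<lambda>i. n * x i)) (P t) \<le> real (2 * n)"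
        unfolding P_def
      proof (rule d_omega1_grid_point_le)
        fix i assume i: "i < n"
        have "n * x i \<le> n * (y i + 2)" "n * y i \<le> n * (x i + 2)"
          using near[OF i] by (intro mult_le_mono2; simp)+
        then show "n * x i \<le> ((w k)(k := t)) i + 2 * n \<and> ((w k)(k := t)) i \<le> n * x i + 2 * n"
          using t lohi by (simp add: w_def algebra_simps)
      qed
      ultimately show ?thesis
        using cov by auto
    qed
    have step: "P t \<in> U \<longleftrightarrow> P (Suc t) \<in> U" if t: "lo \<le> t" "t < hi" for t
    proof -
      obtain V V' where V: "V \<in> \<U>" "P t \<in> V" and V': "V' \<in> \<U>" "P (Suc t) \<in> V'"
        using ex[of t] ex[of "Suc t"] t by auto
      have "d_omega1 (P t) (P (Suc t)) \<le> real 1"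
        unfolding P_def by (rule d_omega1_grid_point_le) simp
      then have d: "d_omega1 (P t) (P (Suc t)) < 2" "d_omega1 (P (Suc t)) (P t) < 2"
        by (simp_all add: d_omega1_commute)
      show ?thesis
        using r_disjointD[OF disj U(1) V'(1) _ V'(2) d(1) d_omega1_nonneg] V'(2)
          r_disjointD[OF disj U(1) V(1) _ V(2) d(2) d_omega1_nonneg] V(2) by blast
    qed
    have "P (n * x k) = grid_point n (w k)"
      by (simp add: P_def w_def fun_upd_idem)
    then have "P (n * x k) \<in> U"
      using Suc by simp
    moreover have "n * x k \<in> {lo..hi}" "n * y k \<in> {lo..hi}"
      by (simp_all add: lo_def hi_def)
    ultimately have "P (n * y k) \<in> U"
      using interval_propagate[of lo hi "\<lambda>t. P t \<in> U" "n * x k" "n * y k", OF step] by blast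
    moreover have "(w k)(k := n * y k) = w (Suc k)"
      by (simp add: fun_eq_iff w_def less_Suc_eq)
    ultimately show ?case
      by (simp add: P_def)
  qed
  from this[of n] have "grid_point n (w n) \<in> U"
    by simp
  moreover have "grid_point n (w n) = grid_point n (\<lambda>i. n * y i)"
    by (simp add: grid_point_def w_def)
  ultimately show ?thesis
    by simp
qed

text \<open>
  Colour the vertex \<open>n x\<close> by some \<open>i \<in> \<sigma>\<close> whose family meets its neighbourhood, and by \<open>2\<close> if
  there is none. Each of these \<open>card \<sigma> + 1 \<le> n\<close> colours falls into far apart bounded classes.
\<close>

lemma insert_2_in_A_family:
  assumes fin: "finite \<sigma>" and card: "card \<sigma> < n" and large: "\<And>i. i \<in> \<sigma> \<Longrightarrow> 6 * n < i"
  shows "insert 2 \<sigma> \<in> A_family d_omega1 X_omega1"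
proof (rule ccontr)
  assume "insert 2 \<sigma> \<notin> A_family d_omega1 X_omega1"
  moreover have "insert 2 \<sigma> \<in> FinN"
  proof -
    have "1 \<le> i" if "i \<in> \<sigma>" for i
      using large[OF that] by simp
    with fin show ?thesis
      by (auto simp: FinN_def)
  qed
  ultimately have "\<exists>\<U> :: nat \<Rightarrow> real list set set.
      (\<forall>i\<in>insert 2 \<sigma>. \<U> i \<subseteq> Pow X_omega1 \<and> uniformly_bounded d_omega1 (\<U> i) \<and>
        r_disjoint d_omega1 (real i) (\<U> i)) \<and> X_omega1 \<subseteq> \<Union> (\<Union>i\<in>insert 2 \<sigma>. \<U> i)"
    unfolding A_family_def mem_Collect_eq by argo
  then obtain \<U> :: "nat \<Rightarrow> real list set set" where
    ball: "\<forall>i\<in>insert 2 \<sigma>. \<U> i \<subseteq> Pow X_omega1 \<and> uniformly_bounded d_omega1 (\<U> i) \<and>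
      r_disjoint d_omega1 (real i) (\<U> i)"
    and cov: "X_omega1 \<subseteq> \<Union> (\<Union>i\<in>insert 2 \<sigma>. \<U> i)"
    by (elim exE conjE)
  note \<U> = bspec[OF ball]
  have n: "n \<ge> 1"
    using card by simp
  have X: "x \<in> X_omega1" if "x \<in> X_piece n" for x
    using that n by (auto simp: X_omega1_def)
  have "\<exists>B. \<forall>U\<in>\<U> i. \<forall>x\<in>U. \<forall>y\<in>U. d_omega1 x y \<le> B" if "i \<in> insert 2 \<sigma>" for i
    using \<U>[OF that] by (meson uniformly_boundedE)
  then obtain b where b: "\<And>i U x y. i \<in> insert 2 \<sigma> \<Longrightarrow> U \<in> \<U> i \<Longrightarrow> x \<in> U \<Longrightarrow> y \<in> U \<Longrightarrow>
      d_omega1 x y \<le> b i"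
    by metis
  obtain B :: nat where "Max (b ` insert 2 \<sigma>) \<le> real B"
    using real_arch_simple by blast
  then have B: "d_omega1 x y \<le> real B" if "i \<in> insert 2 \<sigma>" "U \<in> \<U> i" "x \<in> U" "y \<in> U" for i U x y
    using b[OF that] that(1) fin by (meson Max_ge finite_imageI finite_insert image_eqI order_trans)
  define V where "V x = grid_point n (\<lambda>i. n * x i)" for x
  have V: "V x \<in> X_piece n" for x
    unfolding V_def using n by (intro grid_point_in_X_piece[of 0]) auto
  \<comment> \<open>Colour 2 needs more than a nearby member: the last clause supplies the
    hypotheses of \<open>r_disjoint_neighbourhood\<close>.\<close>
  define good where "good x i U \<longleftrightarrow> i \<in> insert 2 \<sigma> \<and> U \<in> \<U> i \<and>
    (\<exists>z\<in>U. d_omega1 (V x) z \<le> 2 * real n) \<and>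
    (i = 2 \<longrightarrow> V x \<in> U \<and> (\<forall>z\<in>X_piece n. d_omega1 (V x) z \<le> 2 * real n \<longrightarrow> z \<in> \<Union> (\<U> 2)))"
    for x i U
  have two: "2 \<notin> \<sigma>"
    using large[of 2] n by auto
  have "\<exists>i U. good x i U" for x
  proof (cases "\<exists>i\<in>\<sigma>. \<exists>U\<in>\<U> i. \<exists>z\<in>U. d_omega1 (V x) z \<le> 2 * real n")
    case True
    then show ?thesis
      using two unfolding good_def by blast
  next
    case False
    have all: "z \<in> \<Union> (\<U> 2)" if "z \<in> X_piece n" "d_omega1 (V x) z \<le> 2 * real n" for z
      using cov X[OF that(1)] False that(2) by blast
    have V0: "d_omega1 (V x) (V x) \<le> 2 * real n"
      unfolding V_def by (rule order_trans[OF d_omega1_grid_point_le[where k = 0]]) auto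
    then obtain U where "U \<in> \<U> 2" "V x \<in> U"
      using all[OF V] by blast
    then show ?thesis
      using V0 all unfolding good_def by blast
  qed
  then obtain c F where good: "\<And>x. good x (c x) (F x)"
    by metis
  have c: "c x \<in> insert 2 \<sigma>" and F: "F x \<in> \<U> (c x)" for x
    using good[of x] by (auto simp: good_def)
  have "\<exists>z\<in>F x. d_omega1 (V x) z \<le> 2 * real n" for x
    using good[of x] by (auto simp: good_def)
  then obtain z where z: "\<And>x. z x \<in> F x" "\<And>x. d_omega1 (V x) (z x) \<le> 2 * real n"
    by metis
  have zX: "z x \<in> X_omega1" for x
    using \<U>[OF c[of x]] F[of x] z(1)[of x] by blast
  have VX: "V x \<in> X_omega1" for x
    by (rule X[OF V])
  \<comment> \<open>By \<open>card \<sigma> < n\<close> the colours, including 2, can be renumbered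
    below \<open>n\<close>.\<close>
  obtain e where e: "bij_betw e (insert 2 \<sigma>) {0..<card (insert 2 \<sigma>)}"
    using ex_bij_betw_finite_nat fin by blast
  have "card (insert 2 \<sigma>) \<le> n"
    using card two fin by simp
  with e have elt: "e i < n" if "i \<in> insert 2 \<sigma>" for i
    using bij_betwE[OF e] that by fastforce
  have einj: "c x = c y" if "e (c x) = e (c y)" for x y
    by (rule inj_onD[OF bij_betw_imp_inj_on[OF e] that c c])
  show False
  \<comment> \<open>The member \<open>F x\<close> names the class. It has diameter at most
    \<open>B\<close>, and each vertex is within \<open>2 n\<close> of its member, whence
    \<open>B + 4 * n\<close>.\<close>
  proof (rule lebesgue_grid[of n "B + 4 * n" "\<lambda>x. e (c x)" F])
    show "e (c x) < n" for x
      using elt c by blast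
  next
    fix x y assume "e (c x) = e (c y)"
      and near: "\<And>j. j < n \<Longrightarrow> x j \<le> y j + 2 \<and> y j \<le> x j + 2"
    then have cxy: "c x = c y"
      using einj by blast
    note disj = \<U>[OF c[of x], THEN conjunct2, THEN conjunct2]
    have Fy: "F y \<in> \<U> (c x)"
      using F[of y] cxy by simp
    show "F x = F y"
    proof (cases "c x = 2")
      case True
      have Vx: "V x \<in> F x" "V y \<in> F y" and
        nb: "\<And>z. z \<in> X_piece n \<Longrightarrow> d_omega1 (V x) z \<le> 2 * real n \<Longrightarrow> z \<in> \<Union> (\<U> 2)"
        using good[of x] good[of y] True cxy by (auto simp: good_def)
      have "V y \<in> F x"
        unfolding V_def
        by (rule r_disjoint_neighbourhood[of "\<U> 2" n x y "F x"])
          (use disj True nb near F[of x] Vx in \<open>auto simp: V_def\<close>)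
      moreover have "d_omega1 (V y) (V y) < real (c x)"
        unfolding V_def True by (rule le_less_trans[OF d_omega1_grid_point_le[where k = 0]]) auto
      ultimately show ?thesis
        using r_disjointD[OF disj F Fy _ Vx(2) _ d_omega1_nonneg] by blast
    next
      case False
      then have "6 * n < c x"
        using c[of x] large by blast
      \<comment> \<open>Three passages of length at most \<open>2 n\<close> lead from
        \<open>z x\<close> to \<open>z y\<close>; hence the bound \<open>6 * n < i\<close> for
        \<sigma>.\<close>
      have "d_omega1 (V x) (V y) \<le> real (2 * n)"
        unfolding V_def
      proof (rule d_omega1_grid_point_le)
        fix i assume i: "i < n"
        have "n * x i \<le> n * (y i + 2)" "n * y i \<le> n * (x i + 2)"
          using near[OF i] by (intro mult_le_mono2; simp)+
        then show "n * x i \<le> n * y i + 2 * n \<and> n * y i \<le> n * x i + 2 * n"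
          by (simp add: algebra_simps)
      qed
      then have "d_omega1 (z x) (z y) \<le> 6 * real n"
        using d_omega1_triangle[OF zX[of x] VX[of x] zX[of y]]
          d_omega1_triangle[OF VX[of x] VX[of y] zX[of y]] z(2)[of x] z(2)[of y]
        by (simp add: d_omega1_commute[of "z x" "V x"])
      also have "\<dots> < real (c x)"
        using \<open>6 * n < c x\<close> by linarith
      finally show ?thesis
        using r_disjointD[OF disj F Fy z(1) z(1) _ d_omega1_nonneg] by blast
    qed
  next
    fix x y j assume "e (c x) = e (c y)" and Fxy: "F x = F y" and j: "j < n"
    have "d_omega1 (z x) (z y) \<le> real B"
      using B[OF c F, of "z x" x "z y"] z(1)[of x] z(1)[of y] Fxy by simp
    then have "d_omega1 (V x) (V y) \<le> real B + 4 * real n"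
      using d_omega1_triangle[OF VX[of x] zX[of x] VX[of y]]
        d_omega1_triangle[OF zX[of x] zX[of y] VX[of y]] z(2)[of x] z(2)[of y]
      by (simp add: d_omega1_commute[of "z y" "V y"])
    then have "real (n * x j) \<le> real (n * y j) + (real B + 4 * real n)"
      using coordinate_le_d_omega1_grid_point[OF j, of "\<lambda>i. n * x i" "\<lambda>i. n * y i"]
      unfolding V_def by linarith
    then have "real (n * x j) \<le> real (n * y j + (B + 4 * n))"
      by simp
    then have "n * x j \<le> n * y j + (B + 4 * n)"
      by (simp only: of_nat_le_iff)
    \<comment> \<open>Multiplying the constant by \<open>n\<close> allows \<open>n\<close> to be
      cancelled.\<close>
    also have "\<dots> \<le> n * (y j + (B + 4 * n))"
      unfolding add_mult_distrib2[of n "y j" "B + 4 * n"]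
      using mult_le_mono1[OF n, of "B + 4 * n"] by simp
    finally show "x j \<le> y j + (B + 4 * n)"
      using n by simp
  qed
qed

section \<open>Lower bounds and equality\<close>

text \<open>Otherwise the residual at 2 would have a finite ordinal \<open>m\<close>, bounding its
  members by \<open>m\<close> elements, while \<open>insert_2_in_A_family\<close> provides one with
  \<open>m + 1\<close>.\<close>

lemma not_Ord_le_omega: "\<not> Ord_le (A_family d_omega1 X_omega1) (omega :: 'k::infinite ordinal)"
proof
  let ?A = "A_family d_omega1 X_omega1"
  assume "Ord_le ?A (omega :: 'k ordinal)"
  then have "\<exists>\<beta><omega :: 'k ordinal. Ord_le (residual ?A 2) \<beta>"
    unfolding Ord_le_pos_iff[OF omega_pos] by (rule bspec) simp
  then obtain \<beta> :: "'k ordinal" where "\<beta> < omega" "Ord_le (residual ?A 2) \<beta>"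
    by (elim exE conjE)
  then obtain m where "Ord_le (residual ?A 2) ((osuc ^^ m) (0 :: 'k ordinal))"
    unfolding less_omega_iff by (elim exE) simp
  then have m: "card \<tau> \<le> m" if "\<tau> \<in> residual ?A 2" for \<tau>
    using that by (simp add: Ord_le_finite_iff[OF residual_subset_FinN])
  \<comment> \<open>The set \<sigma> has \<open>m + 1\<close> elements and must have fewer than
    \<open>n\<close>.\<close>
  define n where "n = m + 2"
  define \<sigma> where "\<sigma> = {6 * n + 1..6 * n + 1 + m}"
  have "insert 2 \<sigma> \<in> ?A"
    by (rule insert_2_in_A_family[of _ n]) (auto simp: \<sigma>_def n_def)
  then have "\<sigma> \<in> residual ?A 2"
    by (auto simp: residual_def FinN_def \<sigma>_def n_def)
  with m have "card \<sigma> \<le> m"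
    by blast
  then show False
    by (simp add: \<sigma>_def)
qed

theorem mainTheorem1:
  shows "trasdim d_omega1 X_omega1 = Fin (osuc omega :: 'k::infinite ordinal)
    \<and> coasdim d_omega1 X_omega1 = Fin (osuc omega :: 'k ordinal)"
proof
  have eq: "\<delta> = Fin (osuc omega)" if "\<delta> \<le> Fin (osuc omega)" "\<not> \<delta> < Fin (osuc omega)"
    for \<delta> :: "'k ordinal extended"
    using that by (simp add: less_le)
  have less: "\<beta> < osuc (omega :: 'k ordinal) \<longleftrightarrow> \<beta> \<le> omega" for \<beta>
    by (rule less_osuc_iff)
  show "trasdim d_omega1 X_omega1 = Fin (osuc omega :: 'k ordinal)"
    unfolding trasdim_def
  proof (rule eq)
    show "Ord (A_family d_omega1 X_omega1) \<le> Fin (osuc omega :: 'k ordinal)"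
      unfolding Ord_le_iff by (rule Ord_le_osuc_omega_of_coasdim_le[OF coasdim_le_osuc_omega])
    show "\<not> Ord (A_family d_omega1 X_omega1) < Fin (osuc omega :: 'k ordinal)"
      unfolding Ord_less_iff less using not_Ord_le_omega Ord_le_mono by blast
  qed
  show "coasdim d_omega1 X_omega1 = Fin (osuc omega :: 'k ordinal)"
  proof (rule eq)
    show "coasdim d_omega1 X_omega1 \<le> Fin (osuc omega :: 'k ordinal)"
      unfolding coasdim_le_iff by (rule coasdim_le_osuc_omega)
    \<comment> \<open>The bound for \<open>coasdim\<close> is inherited from \<open>trasdim\<close>.
      Afterwards \<open>coasdim_le_empty\<close> handles the alternative \<open>X = {}\<close> in
      \<open>coasdim_less_iff\<close>.\<close>
    have "\<not> coasdim_le d_omega1 X_omega1 (omega :: 'k ordinal)"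
      using not_Ord_le_omega Ord_le_omega_of_coasdim_le by blast
    then show "\<not> coasdim d_omega1 X_omega1 < Fin (osuc omega :: 'k ordinal)"
      unfolding coasdim_less_iff less using coasdim_le_mono coasdim_le_empty by metis
  qed
qed

end
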